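(* Consider a strictly hyperbolic diagonal system $$\cos\phi_i\,(r_i)_x+\sin\phi_i\,(r_i)_y=0,\qquad i=1,\dots,n,$$ where $\phi_i=\phi_i(r_1,\dots,r_n)$ are smooth functions with $\phi_i\neq\phi_j \pmod\pi$ for $i\neq j$. Then the condition $$\partial_{r_k}\left(\frac{\partial_{r_i}\phi_j}{\tan(\phi_i-\phi_j)}\right)=\partial_{r_i}\left(\frac{\partial_{r_k}\phi_j}{\tan(\phi_k-\phi_j)}\right)\qquad\text{for all } j \text{ and all } i,k\neq j$$ is satisfied if and only if the system can (locally, near every point of the space of $r=(r_1,\dots,r_n)$) be written in the form of $n$ conservation laws $$(g_i)_x+(h_i)_y=0,\qquad i=1,\dots,n,$$ with $g_i,h_i$ functions of the unknowns.
   Context: Saying that a quasi-linear system $A(u)u_x+B(u)u_y=0$ can be written in a certain form means that this form can be achieved by a regular change of variables $u=\Psi(w)$ and multiplication by an invertible matrix $C(w)$, i.e. by passing to $C(w)A(\Psi(w))D\Psi(w)\,w_x+C(w)B(\Psi(w))D\Psi(w)\,w_y=0$, where $D$ is the differential. In particular, for the diagonal system (with $A=\mathrm{diag}(\cos\phi_i)$, $B=\mathrm{diag}(\sin\phi_i)$), being written in the form of $n$ conservation laws means that there are smooth functions $g=(g_1,\dots,g_n)$, $h=(h_1,\dots,h_n)$ of $r$ and a smooth invertible matrix $C(r)$ with $Dg=C\,\mathrm{diag}(\cos\phi_1,\dots,\cos\phi_n)$ and $Dh=C\,\mathrm{diag}(\sin\phi_1,\dots,\sin\phi_n)$. Convention: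 $1/\tan(\theta)$ means $\cot\theta=\cos\theta/\sin\theta$ (so it equals $0$ when $\theta=\pi/2\bmod\pi$). *)

theory Defs
  imports "HOL-Analysis.Analysis" "HOL-Library.Real_Mod"
begin

text \<open>
  \<open>Ck_on k S f\<close>: all iterated directional derivatives of \<open>f\<close> of order at most \<open>k\<close> exist and
  are continuous. As the Frechet derivative is taken at full neighbourhoods, this is meant for open
  \<open>S\<close>.
\<close>

primrec Ck_on ::
  "nat \<Rightarrow> 'a::real_normed_vector set \<Rightarrow> ('a \<Rightarrow> 'b::real_normed_vector) \<Rightarrow> bool" where
  "Ck_on 0 S f \<longleftrightarrow> continuous_on S f"
| "Ck_on (Suc k) S f \<longleftrightarrow>
     (\<forall>x\<in>S. f differentiable (at x)) \<and>
     (\<forall>v. Ck_on k S (\<lambda>x. frechet_derivative f (at x) v))"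

definition smooth_on ::
  "'a::real_normed_vector set \<Rightarrow> ('a \<Rightarrow> 'b::real_normed_vector) \<Rightarrow> bool" where
  "smooth_on S f \<longleftrightarrow> (\<forall>k. Ck_on k S f)"

definition partial_deriv :: "'n::finite \<Rightarrow> (real^'n \<Rightarrow> real) \<Rightarrow> real^'n \<Rightarrow> real" where
  "partial_deriv i f r = deriv (\<lambda>t. f (r + t *\<^sub>R axis i 1)) 0"

definition diag_mat :: "('n::finite \<Rightarrow> real) \<Rightarrow> real^'n^'n" where
  "diag_mat d = (\<chi> i j. if i = j then d i else 0)"

text \<open>
  The quasi-linear system \<open>A(r) r\<^sub>x + B(r) r\<^sub>y = 0\<close> takes the form \<open>g(r)\<^sub>x + h(r)\<^sub>y = 0\<close> on \<open>V\<close> after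
  multiplication by an invertible matrix \<open>C(r)\<close>, that is, \<open>Dg = C A\<close> and \<open>Dh = C B\<close>.
\<close>

definition conservation_form_on ::
  "(real^'n) set \<Rightarrow> (real^'n \<Rightarrow> real^'n^'n) \<Rightarrow> (real^'n \<Rightarrow> real^'n^'n) \<Rightarrow> bool" where
  "conservation_form_on V A B \<longleftrightarrow>
     (\<exists>(g :: real^'n \<Rightarrow> real^'n) (h :: real^'n \<Rightarrow> real^'n) (C :: real^'n \<Rightarrow> real^'n^'n).
        smooth_on V g \<and> smooth_on V h \<and> smooth_on V C \<and>
        (\<forall>r\<in>V. invertible (C r) \<and>
          (g has_derivative (\<lambda>v. (C r ** A r) *v v)) (at r) \<and>
          (h has_derivative (\<lambda>v. (C r ** B r) *v v)) (at r)))"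

definition locally_conservation_form ::
  "(real^'n) set \<Rightarrow> (real^'n \<Rightarrow> real^'n^'n) \<Rightarrow> (real^'n \<Rightarrow> real^'n^'n) \<Rightarrow> bool" where
  "locally_conservation_form U A B \<longleftrightarrow>
     (\<forall>p\<in>U. \<exists>V. open V \<and> p \<in> V \<and> V \<subseteq> U \<and> conservation_form_on V A B)"

end

theory Submission
  imports Defs
begin

text \<open>
  A row \<open>\<mu>\<close> of \<open>C\<close> yields a conservation law iff \<open>\<Sum>\<^sub>i \<mu>\<^sub>i cos \<phi>\<^sub>i dr\<^sub>i\<close> and \<open>\<Sum>\<^sub>i \<mu>\<^sub>i sin \<phi>\<^sub>i dr\<^sub>i\<close> are
  closed, that is, iff \<open>\<partial>\<^sub>j \<mu>\<^sub>i = a\<^sub>i\<^sub>j \<mu>\<^sub>i + b\<^sub>i\<^sub>j \<mu>\<^sub>j\<close> for \<open>i \<noteq> j\<close>, where \<open>a\<^sub>i\<^sub>j = \<partial>\<^sub>j \<phi>\<^sub>i cot (\<phi>\<^sub>j - \<phi>\<^sub>i)\<close> and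
  \<open>b\<^sub>i\<^sub>j = \<partial>\<^sub>i \<phi>\<^sub>j / sin (\<phi>\<^sub>i - \<phi>\<^sub>j)\<close>. If \<open>n\<close> independent rows exist, equality of the mixed derivatives
  forces \<open>\<partial>\<^sub>k a\<^sub>i\<^sub>j = \<partial>\<^sub>j a\<^sub>i\<^sub>k\<close>, which is the condition of the theorem. Conversely, this condition
  determines the mixed derivatives \<open>\<partial>\<^sub>i \<partial>\<^sub>k \<phi>\<^sub>j\<close> and thereby also implies the other compatibility
  conditions of the system for \<open>\<mu>\<close>. Darboux's theorem, applied to \<open>\<mu>\<close> together with the fluxes \<open>g\<close>
  and \<open>h\<close>, then gives solutions with arbitrary initial value at a given point.
\<close>

section \<open>Functions of class \<open>C\<^sup>k\<close>\<close>

text \<open>For each pair of indices, closedness of both forms is a linear system of two equations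
  for \<open>\<partial>\<^sub>j \<mu>\<^sub>i\<close> and
  \<open>\<partial>\<^sub>i \<mu>\<^sub>j\<close>. Its determinant is
  \<open>sin (\<phi>\<^sub>i - \<phi>\<^sub>j)\<close>, so strict hyperbolicity makes it uniquely
  solvable; this is where the coefficients come from. The derivative of \<open>\<mu>\<^sub>i\<close>
  in its own direction stays free. The system is therefore not a total differential system to which
  Frobenius' theorem would apply directly: each unknown has its own set of directions, and it is
  recovered by integrating along segments that shrink only these coordinates towards the base point.
  On the slice where the segments start, the unknown is taken constant. The unknowns are coupled,
  hence a fixed point argument. Differentiating the integral equation gives an equation of the same
  kind with no larger contraction constant, so a single ball serves for all orders of smoothness.
  Treating the fluxes as unknowns with all directions prescribed lets the same theorem also
  integrate the closed forms.\<close>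

lemma Ck_on_cong:
  assumes "open S" "\<And>x. x \<in> S \<Longrightarrow> f x = g x"
  shows "Ck_on k S f \<longleftrightarrow> Ck_on k S g"
  using assms(2)
proof (induction k arbitrary: f g)
  case 0
  then show ?case by (simp cong: continuous_on_cong)
next
  case (Suc k)
  have D: "(f has_derivative f') (at x) \<longleftrightarrow> (g has_derivative f') (at x)" if "x \<in> S" for x f'
    using has_derivative_transform_within_open[OF _ assms(1) that] Suc.prems by (metis (no_types, lifting))
  then have "frechet_derivative f (at x) = frechet_derivative g (at x)" if "x \<in> S" for x
    using that unfolding frechet_derivative_def by simp
  then have "Ck_on k S (\<lambda>x. frechet_derivative f (at x) v) \<longleftrightarrow>
      Ck_on k S (\<lambda>x. frechet_derivative g (at x) v)" for v
    by (intro Suc.IH) simp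
  then show ?case using D by (auto simp: differentiable_def)
qed

text \<open>Lets the derivative be given by any convenient formula; most closure properties below
  are proved through this rule.\<close>

lemma Ck_on_SucI:
  assumes "open S" "\<And>x. x \<in> S \<Longrightarrow> (f has_derivative f' x) (at x)"
    and "\<And>v. Ck_on k S (\<lambda>x. f' x v)"
  shows "Ck_on (Suc k) S f"
proof -
  have "Ck_on k S (\<lambda>x. frechet_derivative f (at x) v)" for v
    using assms(3)[of v] Ck_on_cong[OF assms(1), of "\<lambda>x. frechet_derivative f (at x) v" "\<lambda>x. f' x v"]
      frechet_derivative_at[OF assms(2)] by metis
  with assms(2) show ?thesis by (auto simp: differentiable_def)
qed

lemma Ck_on_Suc_has_derivative:
  "Ck_on (Suc k) S f \<Longrightarrow> x \<in> S \<Longrightarrow> (f has_derivative frechet_derivative f (at x)) (at x)"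
  by (simp add: frechet_derivative_works)

text \<open>The recursive clause for \<open>Suc k\<close> does not contain order \<open>k\<close>.
  The descent ends at order 0, where differentiability implies continuity.\<close>

lemma Ck_on_Suc_imp: "Ck_on (Suc k) S f \<Longrightarrow> Ck_on k S f"
proof (induction k arbitrary: f)
  case 0
  then show ?case
    by (auto intro!: continuous_at_imp_continuous_on differentiable_imp_continuous_within)
qed auto

lemma Ck_on_le: "k \<le> l \<Longrightarrow> Ck_on l S f \<Longrightarrow> Ck_on k S f"
  by (induction l) (auto simp: le_Suc_eq dest: Ck_on_Suc_imp simp del: Ck_on.simps)

lemma Ck_on_continuous_on: "Ck_on k S f \<Longrightarrow> continuous_on S f"
  using Ck_on_le[of 0 k] by simp

lemma Ck_on_subset: "Ck_on k S f \<Longrightarrow> T \<subseteq> S \<Longrightarrow> Ck_on k T f"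
  by (induction k arbitrary: f) (auto intro: continuous_on_subset)

lemma Ck_on_const: "Ck_on k S (\<lambda>x. c)"
  by (induction k arbitrary: c) auto

lemma Ck_on_add:
  assumes "open S" "Ck_on k S f" "Ck_on k S g"
  shows "Ck_on k S (\<lambda>x. f x + g x)"
  using assms(2,3)
proof (induction k arbitrary: f g)
  case (Suc k)
  show ?case
  proof (rule Ck_on_SucI[OF assms(1)])
    show "((\<lambda>x. f x + g x) has_derivative
        (\<lambda>v. frechet_derivative f (at x) v + frechet_derivative g (at x) v)) (at x)" if "x \<in> S" for x
      by (intro has_derivative_add Ck_on_Suc_has_derivative[OF Suc.prems(1) that]
          Ck_on_Suc_has_derivative[OF Suc.prems(2) that])
    show "Ck_on k S (\<lambda>x. frechet_derivative f (at x) v + frechet_derivative g (at x) v)" for v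
      using Suc.prems by (intro Suc.IH) simp_all
  qed
qed (auto intro: continuous_intros)

lemma Ck_on_sum:
  assumes "open S" "\<And>i. i \<in> I \<Longrightarrow> Ck_on k S (f i)"
  shows "Ck_on k S (\<lambda>x. \<Sum>i\<in>I. f i x)"
  using assms(2) by (induction I rule: infinite_finite_induct) (auto intro: Ck_on_const Ck_on_add assms(1))

lemma Ck_on_bounded_linear:
  assumes "open S" "bounded_linear L" "Ck_on k S f"
  shows "Ck_on k S (\<lambda>x. L (f x))"
  using assms(3)
proof (induction k arbitrary: f)
  case 0
  then show ?case by (auto intro!: bounded_linear.continuous_on[OF assms(2)])
next
  case (Suc k)
  show ?case
  proof (rule Ck_on_SucI[OF assms(1)])
    show "((\<lambda>x. L (f x)) has_derivative (\<lambda>v. L (frechet_derivative f (at x) v))) (at x)" if "x \<in> S" for x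
      by (intro bounded_linear.has_derivative[OF assms(2)] Ck_on_Suc_has_derivative[OF Suc.prems that])
    show "Ck_on k S (\<lambda>x. L (frechet_derivative f (at x) v))" for v
      using Suc.prems by (intro Suc.IH) simp_all
  qed
qed

lemma Ck_on_bounded_bilinear:
  assumes "bounded_bilinear b" "open S" "Ck_on k S f" "Ck_on k S g"
  shows "Ck_on k S (\<lambda>x. b (f x) (g x))"
  using assms(3,4)
proof (induction k arbitrary: f g)
  case 0
  then show ?case by (auto intro!: bounded_bilinear.continuous_on[OF assms(1)])
next
  case (Suc k)
  show ?case
  proof (rule Ck_on_SucI[OF assms(2)])
    show "((\<lambda>x. b (f x) (g x)) has_derivative
        (\<lambda>v. b (f x) (frechet_derivative g (at x) v) + b (frechet_derivative f (at x) v) (g x))) (at x)"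
      if "x \<in> S" for x
      by (intro bounded_bilinear.FDERIV[OF assms(1)] Ck_on_Suc_has_derivative[OF Suc.prems(1) that]
          Ck_on_Suc_has_derivative[OF Suc.prems(2) that])
    show "Ck_on k S (\<lambda>x. b (f x) (frechet_derivative g (at x) v) + b (frechet_derivative f (at x) v) (g x))" for v
      using Suc.prems Suc.prems[THEN Ck_on_Suc_imp] by (intro Ck_on_add[OF assms(2)] Suc.IH) simp_all
  qed
qed

lemmas Ck_on_mult = Ck_on_bounded_bilinear[OF bounded_bilinear_mult]
lemmas Ck_on_scaleR = Ck_on_bounded_bilinear[OF bounded_bilinear_scaleR]

lemma Ck_on_compose:
  fixes f :: "'b::euclidean_space \<Rightarrow> 'c::real_normed_vector"
  assumes "open S" "Ck_on k T f" "Ck_on k S g" "g ` S \<subseteq> T"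
  shows "Ck_on k S (\<lambda>x. f (g x))"
  using assms(2,3)
proof (induction k arbitrary: f)
  case 0
  then show ?case using continuous_on_compose2[of T f S g] assms(4) by simp
next
  case (Suc k)
  show ?case
  proof (rule Ck_on_SucI[OF assms(1)])
    fix x assume x: "x \<in> S"
    let ?f' = "frechet_derivative f (at (g x))" and ?g' = "frechet_derivative g (at x)"
    have f': "(f has_derivative ?f') (at (g x))"
      using assms(4) x Suc.prems(1) by (intro Ck_on_Suc_has_derivative) auto
    have "((\<lambda>x. f (g x)) has_derivative (\<lambda>v. ?f' (?g' v))) (at x)"
      using has_derivative_compose[OF Ck_on_Suc_has_derivative[OF Suc.prems(2) x] f'] .
    \<comment> \<open>The direction \<open>?g' v\<close> varies with the point, while
      \<open>Ck_on\<close> speaks of fixed directions. The basis expansion moves the variation into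
      scalar coefficients.\<close>
    also have "(\<lambda>v. ?f' (?g' v)) = (\<lambda>v. \<Sum>b\<in>Basis. (?g' v \<bullet> b) *\<^sub>R ?f' b)"
    proof
      fix v
      have "?f' (?g' v) = ?f' (\<Sum>b\<in>Basis. (?g' v \<bullet> b) *\<^sub>R b)"
        by (simp add: euclidean_representation)
      then show "?f' (?g' v) = (\<Sum>b\<in>Basis. (?g' v \<bullet> b) *\<^sub>R ?f' b)"
        using has_derivative_linear[OF f'] by (simp add: linear_sum linear_cmul)
    qed
    finally show "((\<lambda>x. f (g x)) has_derivative (\<lambda>v. \<Sum>b\<in>Basis. (?g' v \<bullet> b) *\<^sub>R ?f' b)) (at x)" .
  next
    fix v
    show "Ck_on k S (\<lambda>x. \<Sum>b\<in>Basis. (frechet_derivative g (at x) v \<bullet> b) *\<^sub>R frechet_derivative f (at (g x)) b)"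
    proof (intro Ck_on_sum Ck_on_scaleR assms(1) Suc.IH Ck_on_bounded_linear[OF assms(1) bounded_linear_inner_left])
      show "Ck_on k S g" by (rule Ck_on_Suc_imp[OF Suc.prems(2)])
    qed (use Suc.prems in auto)
  qed
qed

section \<open>Closure properties of smooth functions\<close>

lemma smooth_onI: "(\<And>k. Ck_on k S f) \<Longrightarrow> smooth_on S f"
  by (simp add: smooth_on_def)

lemma smooth_onD: "smooth_on S f \<Longrightarrow> Ck_on k S f"
  by (simp add: smooth_on_def)

lemma smooth_on_has_derivative:
  "smooth_on S f \<Longrightarrow> x \<in> S \<Longrightarrow> (f has_derivative frechet_derivative f (at x)) (at x)"
  using Ck_on_Suc_has_derivative smooth_onD by blast

lemma smooth_on_frechet_derivative:
  "smooth_on S f \<Longrightarrow> smooth_on S (\<lambda>x. frechet_derivative f (at x) v)"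
  unfolding smooth_on_def by (metis Ck_on.simps(2))

lemma smooth_on_continuous_on: "smooth_on S f \<Longrightarrow> continuous_on S f"
  using Ck_on_continuous_on smooth_onD by blast

lemma smooth_on_subset: "smooth_on S f \<Longrightarrow> T \<subseteq> S \<Longrightarrow> smooth_on T f"
  unfolding smooth_on_def using Ck_on_subset by blast

lemma smooth_on_const: "smooth_on S (\<lambda>x. c)"
  by (simp add: smooth_on_def Ck_on_const)

lemma smooth_on_add:
  "open S \<Longrightarrow> smooth_on S f \<Longrightarrow> smooth_on S g \<Longrightarrow> smooth_on S (\<lambda>x. f x + g x)"
  by (simp add: smooth_on_def Ck_on_add)

lemma smooth_on_sum:
  "open S \<Longrightarrow> (\<And>i. i \<in> I \<Longrightarrow> smooth_on S (f i)) \<Longrightarrow> smooth_on S (\<lambda>x. \<Sum>i\<in>I. f i x)"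
  by (simp add: smooth_on_def Ck_on_sum)

lemma smooth_on_bounded_linear:
  "open S \<Longrightarrow> bounded_linear L \<Longrightarrow> smooth_on S f \<Longrightarrow> smooth_on S (\<lambda>x. L (f x))"
  by (simp add: smooth_on_def Ck_on_bounded_linear)

lemma smooth_on_mult:
  fixes f g :: "_ \<Rightarrow> 'b::real_normed_algebra"
  shows "open S \<Longrightarrow> smooth_on S f \<Longrightarrow> smooth_on S g \<Longrightarrow> smooth_on S (\<lambda>x. f x * g x)"
  by (simp add: smooth_on_def Ck_on_mult)

lemma smooth_on_minus: "open S \<Longrightarrow> smooth_on S f \<Longrightarrow> smooth_on S (\<lambda>x. - f x)"
  by (rule smooth_on_bounded_linear) (auto intro: bounded_linear_minus bounded_linear_ident)

lemma smooth_on_diff: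
  "open S \<Longrightarrow> smooth_on S f \<Longrightarrow> smooth_on S g \<Longrightarrow> smooth_on S (\<lambda>x. f x - g x)"
  using smooth_on_add[of S f "\<lambda>x. - g x"] smooth_on_minus by auto

lemma smooth_on_compose:
  fixes f :: "'b::euclidean_space \<Rightarrow> 'c::real_normed_vector"
  shows "open S \<Longrightarrow> smooth_on T f \<Longrightarrow> smooth_on S g \<Longrightarrow> g ` S \<subseteq> T \<Longrightarrow> smooth_on S (\<lambda>x. f (g x))"
  unfolding smooth_on_def using Ck_on_compose by blast

lemma smooth_on_ident: "smooth_on S (\<lambda>x. x)"
proof (rule smooth_onI)
  show "Ck_on k S (\<lambda>x. x)" for k
    by (cases k) (auto simp: frechet_derivative_ident Ck_on_const)
qed

lemma smooth_on_linear: "open S \<Longrightarrow> bounded_linear L \<Longrightarrow> smooth_on S L"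
  using smooth_on_bounded_linear[OF _ _ smooth_on_ident] .

text \<open>Proved jointly, since each function is up to sign the derivative of the other.\<close>

lemma Ck_on_sin_cos: "Ck_on k UNIV (sin :: real \<Rightarrow> real) \<and> Ck_on k UNIV (cos :: real \<Rightarrow> real)"
proof (induction k)
  case 0
  then show ?case by (simp add: continuous_on_sin continuous_on_cos)
next
  case (Suc k)
  have "Ck_on (Suc k) UNIV (sin :: real \<Rightarrow> real)"
  proof (rule Ck_on_SucI)
    show "(sin has_derivative (\<lambda>v. v * cos x)) (at x)" for x :: real
      by (auto intro!: derivative_eq_intros)
    show "Ck_on k UNIV (\<lambda>x. v * cos x)" for v :: real
      using Suc by (intro Ck_on_mult Ck_on_const) simp_all
  qed simp
  moreover have "Ck_on (Suc k) UNIV (cos :: real \<Rightarrow> real)"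
  proof (rule Ck_on_SucI)
    show "(cos has_derivative (\<lambda>v. (- v) * sin x)) (at x)" for x :: real
      by (auto intro!: derivative_eq_intros)
    show "Ck_on k UNIV (\<lambda>x. (- v) * sin x)" for v :: real
      using Suc by (intro Ck_on_mult Ck_on_const) simp_all
  qed simp
  ultimately show ?case ..
qed

lemma smooth_on_sin:
  fixes f :: "_ \<Rightarrow> real"
  shows "open S \<Longrightarrow> smooth_on S f \<Longrightarrow> smooth_on S (\<lambda>x. sin (f x))"
  by (rule smooth_on_compose[of _ UNIV]) (auto simp: smooth_on_def Ck_on_sin_cos)

lemma smooth_on_cos:
  fixes f :: "_ \<Rightarrow> real"
  shows "open S \<Longrightarrow> smooth_on S f \<Longrightarrow> smooth_on S (\<lambda>x. cos (f x))"
  by (rule smooth_on_compose[of _ UNIV]) (auto simp: smooth_on_def Ck_on_sin_cos)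

lemma smooth_on_inverse:
  fixes f :: "_ \<Rightarrow> real"
  assumes "open S" "smooth_on S f" "\<And>x. x \<in> S \<Longrightarrow> f x \<noteq> 0"
  shows "smooth_on S (\<lambda>x. inverse (f x))"
proof -
  have op: "open (- {0::real})" by auto
  \<comment> \<open>The derivative of \<open>inverse\<close> is a polynomial in
    \<open>inverse\<close>, so the induction feeds itself; a general \<open>f\<close> enters by
    composition afterwards.\<close>
  have "Ck_on k (- {0}) (inverse :: real \<Rightarrow> real)" for k
  proof (induction k)
    case 0
    then show ?case using continuous_on_inverse[OF continuous_on_id, of "- {0::real}"] by simp
  next
    case (Suc k)
    show ?case
    proof (rule Ck_on_SucI[OF op])
      show "(inverse has_derivative (\<lambda>v. - (inverse x * v * inverse x))) (at x)" if "x \<in> - {0}" for x :: real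
        using that by (intro has_derivative_inverse') simp
      show "Ck_on k (- {0}) (\<lambda>x. - (inverse x * v * inverse x))" for v :: real
        by (rule Ck_on_bounded_linear[OF op bounded_linear_minus[OF bounded_linear_ident]],
            rule Ck_on_mult[OF op Ck_on_mult[OF op Suc Ck_on_const] Suc])
    qed
  qed
  then have "smooth_on (- {0}) (inverse :: real \<Rightarrow> real)" by (rule smooth_onI)
  then show ?thesis
    by (rule smooth_on_compose[OF assms(1) _ assms(2)]) (use assms(3) in auto)
qed

lemma smooth_on_divide:
  fixes f g :: "_ \<Rightarrow> real"
  shows "open S \<Longrightarrow> smooth_on S f \<Longrightarrow> smooth_on S g \<Longrightarrow> (\<And>x. x \<in> S \<Longrightarrow> g x \<noteq> 0)
    \<Longrightarrow> smooth_on S (\<lambda>x. f x / g x)"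
  unfolding divide_inverse by (intro smooth_on_mult smooth_on_inverse)

lemma smooth_on_cot:
  fixes f :: "_ \<Rightarrow> real"
  shows "open S \<Longrightarrow> smooth_on S f \<Longrightarrow> (\<And>x. x \<in> S \<Longrightarrow> sin (f x) \<noteq> 0) \<Longrightarrow> smooth_on S (\<lambda>x. cot (f x))"
  unfolding cot_def by (intro smooth_on_divide smooth_on_sin smooth_on_cos)

lemma smooth_on_vec:
  fixes f :: "'n::finite \<Rightarrow> 'a::real_normed_vector \<Rightarrow> 'b::euclidean_space"
  assumes "open S" "\<And>i. smooth_on S (f i)"
  shows "smooth_on S (\<lambda>x. \<chi> i. f i x)"
proof -
  have bl: "bounded_linear (axis i :: 'b \<Rightarrow> 'b^'n)" for i
    by (auto intro!: linear_conv_bounded_linear[THEN iffD1] linearI simp: vec_eq_iff axis_def)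
  have "(\<lambda>x. \<chi> i. f i x) = (\<lambda>x. \<Sum>i\<in>UNIV. axis i (f i x))"
    by (auto simp: vec_eq_iff axis_def)
  moreover have "smooth_on S (\<lambda>x. \<Sum>i\<in>UNIV. axis i (f i x))"
    by (intro smooth_on_sum smooth_on_bounded_linear[OF _ bl] assms)
  ultimately show ?thesis by simp
qed

text \<open>
  Applying the mean value theorem twice to the second difference of \<open>f\<close> over a parallelogram, in
  both orders, produces values of the two mixed derivatives at nearby points that coincide.
\<close>

lemma frechet_derivative_commute:
  fixes f :: "'a::real_normed_vector \<Rightarrow> real"
  assumes "open S" "Ck_on 2 S f" "x \<in> S"
  shows "frechet_derivative (\<lambda>y. frechet_derivative f (at y) v) (at x) w =
    frechet_derivative (\<lambda>y. frechet_derivative f (at y) w) (at x) v"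
proof -
  define D where "D v = (\<lambda>y. frechet_derivative f (at y) v)" for v
  define DD where "DD v w = (\<lambda>y. frechet_derivative (D v) (at y) w)" for v w
  have C: "Ck_on (Suc (Suc 0)) S f" using assms(2) by (simp add: numeral_2_eq_2)
  have f: "(f has_derivative (\<lambda>v. D v y)) (at y)" if "y \<in> S" for y
    unfolding D_def using Ck_on_Suc_has_derivative[OF C that] by simp
  have CD: "Ck_on (Suc 0) S (D v)" for v
    using C by (simp add: D_def)
  have Df: "(D v has_derivative (\<lambda>w. DD v w y)) (at y)" if "y \<in> S" for v y
    unfolding DD_def by (rule Ck_on_Suc_has_derivative[OF CD that])
  have cont: "continuous_on S (DD v w)" for v w
    using CD[of v] by (simp add: DD_def)
  obtain e where e: "e > 0" "ball x e \<subseteq> S" using assms(1,3) openE by blast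
  \<comment> \<open>The summand 1 keeps \<open>M\<close> positive for \<open>v = w = 0\<close> and
    makes the last inequality of \<open>seg\<close> strict.\<close>
  define M where "M = norm v + norm w + 1"
  have M: "M > 0" "norm v < M" "norm w < M" by (auto simp: M_def add_nonneg_pos)
  have seg: "x + a *\<^sub>R v + b *\<^sub>R w \<in> ball x (h * M)" if "0 \<le> a" "a \<le> h" "0 \<le> b" "b \<le> h" "h > 0" for a b h
  proof -
    have "norm (a *\<^sub>R v + b *\<^sub>R w) \<le> a * norm v + b * norm w"
      using that norm_triangle_ineq[of "a *\<^sub>R v" "b *\<^sub>R w"] by simp
    also have "\<dots> \<le> h * norm v + h * norm w"
      using that by (intro add_mono mult_right_mono) auto
    also have "\<dots> < h * M" using that by (simp add: M_def algebra_simps)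
    finally show ?thesis
      unfolding mem_ball by (subst dist_commute) (simp add: dist_norm add.assoc)
  qed
  \<comment> \<open>Here \<open>v\<close> and \<open>w\<close> are fresh, so that the fact applies
    to both orders. As \<open>M\<close> belongs to the original pair, the containment of the
    parallelogram is passed as a hypothesis.\<close>
  have mvt: "\<exists>y\<in>ball x (h * M). f (x + h *\<^sub>R v + h *\<^sub>R w) - f (x + h *\<^sub>R v) - f (x + h *\<^sub>R w) + f x = h * h * DD v w y"
    if h: "h > 0" "h * M < e" and seg: "\<And>a b. 0 \<le> a \<Longrightarrow> a \<le> h \<Longrightarrow> 0 \<le> b \<Longrightarrow> b \<le> h \<Longrightarrow> x + a *\<^sub>R v + b *\<^sub>R w \<in> ball x (h * M)" for h v w
  proof -
    have inS: "x + a *\<^sub>R v + b *\<^sub>R w \<in> S" if "0 \<le> a" "a \<le> h" "0 \<le> b" "b \<le> h" for a b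
      using seg[OF that] h(2) e(2) by auto
    define q where "q s = f (x + s *\<^sub>R v + h *\<^sub>R w) - f (x + s *\<^sub>R v + 0 *\<^sub>R w)" for s
    have q': "(q has_derivative (\<lambda>t. t * (D v (x + s *\<^sub>R v + h *\<^sub>R w) - D v (x + s *\<^sub>R v + 0 *\<^sub>R w)))) (at s)"
      if "0 \<le> s" "s \<le> h" for s
    proof -
      have *: "((\<lambda>s. f (x + s *\<^sub>R v + b *\<^sub>R w)) has_derivative (\<lambda>t. D (t *\<^sub>R v) (x + s *\<^sub>R v + b *\<^sub>R w))) (at s)"
        if "0 \<le> b" "b \<le> h" for b
      proof -
        have g: "((\<lambda>s. x + s *\<^sub>R v + b *\<^sub>R w) has_derivative (\<lambda>t. t *\<^sub>R v)) (at s)"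
          by (auto intro!: derivative_eq_intros)
        have y: "x + s *\<^sub>R v + b *\<^sub>R w \<in> S" using \<open>0 \<le> s\<close> \<open>s \<le> h\<close> that inS by simp
        show ?thesis using has_derivative_compose[OF g f[OF y]] .
      qed
      have lin: "D (t *\<^sub>R v) (x + s *\<^sub>R v + b *\<^sub>R w) = t * D v (x + s *\<^sub>R v + b *\<^sub>R w)"
        if "0 \<le> b" "b \<le> h" for b t
        using linear_cmul[OF has_derivative_linear[OF f[OF inS]]] \<open>0 \<le> s\<close> \<open>s \<le> h\<close> that by simp
      show ?thesis
        unfolding q_def using has_derivative_diff[OF *[of h] *[of 0]] h(1) lin[of h] lin[of 0]
        by (simp add: right_diff_distrib)
    qed
    obtain s where s: "0 < s" "s < h"
      and qs: "q h - q 0 = h * (D v (x + s *\<^sub>R v + h *\<^sub>R w) - D v (x + s *\<^sub>R v + 0 *\<^sub>R w))"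
      using mvt_simple[OF h(1) has_derivative_at_withinI[OF q']] by auto
    have r': "((\<lambda>b. D v (x + s *\<^sub>R v + b *\<^sub>R w)) has_derivative (\<lambda>t. t * DD v w (x + s *\<^sub>R v + b *\<^sub>R w))) (at b)"
      if "0 \<le> b" "b \<le> h" for b
    proof -
      have y: "x + s *\<^sub>R v + b *\<^sub>R w \<in> S" using inS s that by auto
      have g: "((\<lambda>b. x + s *\<^sub>R v + b *\<^sub>R w) has_derivative (\<lambda>t. t *\<^sub>R w)) (at b)"
        by (auto intro!: derivative_eq_intros)
      have "((\<lambda>b. D v (x + s *\<^sub>R v + b *\<^sub>R w)) has_derivative (\<lambda>t. DD v (t *\<^sub>R w) (x + s *\<^sub>R v + b *\<^sub>R w))) (at b)"
        using has_derivative_compose[OF g Df[OF y]] .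
      then show ?thesis
        using linear_cmul[OF has_derivative_linear[OF Df[OF y]]] by simp
    qed
    obtain b where b: "0 < b" "b < h"
      "D v (x + s *\<^sub>R v + h *\<^sub>R w) - D v (x + s *\<^sub>R v + 0 *\<^sub>R w) = h * DD v w (x + s *\<^sub>R v + b *\<^sub>R w)"
      using mvt_simple[OF h(1) has_derivative_at_withinI[OF r']] by auto
    show ?thesis
      using qs b s seg[of s b] by (intro bexI[of _ "x + s *\<^sub>R v + b *\<^sub>R w"]) (auto simp: q_def)
  qed
  define h where "h n = e / M / 2 * inverse (real (Suc n))" for n
  have h: "h n > 0" "h n * M < e" for n
  proof -
    show "h n > 0" using e(1) M(1) by (simp add: h_def)
    have "h n * M = e / 2 * inverse (real (Suc n))" using M(1) by (simp add: h_def)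
    also have "\<dots> \<le> e / 2 * 1"
      using e(1) by (intro mult_left_mono) (auto simp: inverse_eq_divide)
    finally show "h n * M < e" using e(1) by simp
  qed
  have "\<exists>y z. y \<in> ball x (h n * M) \<and> z \<in> ball x (h n * M) \<and> DD v w y = DD w v z" for n
  proof -
    obtain y where y: "y \<in> ball x (h n * M)"
      "f (x + h n *\<^sub>R v + h n *\<^sub>R w) - f (x + h n *\<^sub>R v) - f (x + h n *\<^sub>R w) + f x = h n * h n * DD v w y"
      using mvt[OF h(1) h(2), of n v w] seg h by blast
    have "x + a *\<^sub>R w + b *\<^sub>R v \<in> ball x (h n * M)" if "0 \<le> a" "a \<le> h n" "0 \<le> b" "b \<le> h n" for a b
      using seg[of b "h n" a] that h by (simp add: algebra_simps)
    then obtain z where z: "z \<in> ball x (h n * M)"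
      "f (x + h n *\<^sub>R w + h n *\<^sub>R v) - f (x + h n *\<^sub>R w) - f (x + h n *\<^sub>R v) + f x = h n * h n * DD w v z"
      using mvt[OF h(1) h(2), of n w v] by blast
    have "h n * h n * DD v w y = h n * h n * DD w v z"
      using y(2) z(2) by (simp add: algebra_simps)
    then show ?thesis using y(1) z(1) h(1)[of n] by auto
  qed
  then obtain y z where yz: "\<And>n. y n \<in> ball x (h n * M)" "\<And>n. z n \<in> ball x (h n * M)"
    "\<And>n. DD v w (y n) = DD w v (z n)" by metis
  have h0: "(\<lambda>n. h n * M) \<longlonglongrightarrow> 0"
    unfolding h_def by (intro tendsto_mult_left_zero tendsto_mult_right_zero LIMSEQ_inverse_real_of_nat)
  have lim: "u \<longlonglongrightarrow> x" if "\<And>n. u n \<in> ball x (h n * M)" for u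
    using that by (intro metric_tendsto_imp_tendsto[OF h0])
      (auto intro!: always_eventually simp: dist_commute less_imp_le less_le_trans[OF _ abs_ge_self])
  have c: "isCont (DD v w) x" "isCont (DD w v) x"
    using cont assms(1,3) by (auto simp: continuous_on_eq_continuous_at)
  have "(\<lambda>n. DD v w (y n)) \<longlonglongrightarrow> DD v w x" "(\<lambda>n. DD w v (z n)) \<longlonglongrightarrow> DD w v x"
    using isCont_tendsto_compose[OF c(1) lim[OF yz(1)]] isCont_tendsto_compose[OF c(2) lim[OF yz(2)]] .
  then have "DD v w x = DD w v x" using yz(3) LIMSEQ_unique by simp
  then show ?thesis by (simp add: DD_def D_def)
qed

section \<open>Integrals depending on a parameter\<close>

lemma continuous_on_integral_unit:
  fixes F :: "'a::topological_space \<times> real \<Rightarrow> real"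
  assumes "continuous_on (V \<times> {0..1}) F"
  shows "continuous_on V (\<lambda>x. integral {0..1} (\<lambda>t. F (x, t)))"
  using integral_continuous_on_param[of V 0 1 "\<lambda>x t. F (x, t)"] assms by simp

text \<open>Differentiation under the integral sign. \<open>F\<close> is controlled on a larger set
  \<open>W\<close> because \<open>Ck_on\<close> takes derivatives at full neighbourhoods, and
  \<open>V \<times> {0..1}\<close> contains none around points with \<open>t = 0\<close> or
  \<open>t = 1\<close>.\<close>

lemma has_derivative_integral_unit:
  fixes F :: "'a::euclidean_space \<times> real \<Rightarrow> real"
  assumes W: "V \<times> {0..1} \<subseteq> W" and V: "open V" "x \<in> V" and F: "Ck_on (Suc 0) W F"
  shows "((\<lambda>x. integral {0..1} (\<lambda>t. F (x, t))) has_derivative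
    (\<lambda>v. integral {0..1} (\<lambda>t. frechet_derivative F (at (x, t)) (v, 0)))) (at x)"
proof -
  define F' where "F' x t = Blinfun (\<lambda>v. frechet_derivative F (at (x, t)) (v, 0))" for x t
  have pair: "((\<lambda>x. (x, t)) has_derivative (\<lambda>v. (v, 0))) (at x)" for x :: 'a and t :: real
    by (auto intro!: derivative_eq_intros)
  have deriv: "((\<lambda>x. F (x, t)) has_derivative (\<lambda>v. frechet_derivative F (at (x, t)) (v, 0))) (at x)"
    if "x \<in> V" "t \<in> {0..1}" for x t
  proof -
    have "(x, t) \<in> W" using W that by blast
    then show ?thesis using has_derivative_compose[OF pair Ck_on_Suc_has_derivative[OF F]] by blast
  qed
  have F': "blinfun_apply (F' x t) = (\<lambda>v. frechet_derivative F (at (x, t)) (v, 0))"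
    if "x \<in> V" "t \<in> {0..1}" for x t
    unfolding F'_def by (rule bounded_linear_Blinfun_apply[OF has_derivative_bounded_linear[OF deriv[OF that]]])
  \<comment> \<open>The Leibniz rule asks for a convex parameter set, hence the passage to a
    ball.\<close>
  obtain e where e: "e > 0" "ball x e \<subseteq> V" using V openE by blast
  have sub: "ball x e \<times> {0..1} \<subseteq> W" using W e by blast
  have cont: "continuous_on (ball x e \<times> {0..1}) (\<lambda>(x, t). F' x t)"
  proof (rule continuous_on_blinfun_componentwise)
    fix v :: 'a
    have "continuous_on (ball x e \<times> {0..1}) (\<lambda>z. frechet_derivative F (at z) (v, 0))"
      using F by (intro continuous_on_subset[OF _ sub]) simp
    then show "continuous_on (ball x e \<times> {0..1}) (\<lambda>z. blinfun_apply (case z of (x, t) \<Rightarrow> F' x t) v)"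
      by (rule continuous_on_cong[THEN iffD1, rotated -1]) (use e F' in auto)
  qed
  have "((\<lambda>x. integral (cbox 0 1) (\<lambda>t. F (x, t))) has_derivative blinfun_apply (integral (cbox 0 1) (F' x)))
      (at x within ball x e)"
  proof (rule leibniz_rule)
    show "((\<lambda>x. F (x, t)) has_derivative blinfun_apply (F' y t)) (at y within ball x e)"
      if "y \<in> ball x e" "t \<in> cbox 0 1" for y t
    proof -
      have "y \<in> V" "t \<in> {0..1}" using that e by auto
      then show ?thesis using deriv F' by (simp add: has_derivative_at_withinI)
    qed
    show "(\<lambda>t. F (y, t)) integrable_on cbox 0 1" if "y \<in> ball x e" for y
    proof (rule integrable_continuous)
      show "continuous_on (cbox 0 1) (\<lambda>t. F (y, t))"
        using that sub
        by (intro continuous_on_compose2[OF Ck_on_continuous_on[OF F], of _ "Pair y"])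
          (auto intro!: continuous_intros)
    qed
  qed (use cont e in auto)
  also have "blinfun_apply (integral (cbox 0 1) (F' x)) =
      (\<lambda>v. integral {0..1} (\<lambda>t. frechet_derivative F (at (x, t)) (v, 0)))"
  proof
    fix v
    have "continuous_on {0..1} (F' x)"
    proof -
      have "continuous_on {0..1} (Pair x)" "Pair x ` {0..1} \<subseteq> ball x e \<times> {0..1}"
        using e by (auto simp: continuous_on_Pair)
      then show ?thesis using continuous_on_compose2[OF cont, of "{0..1}" "Pair x"] by simp
    qed
    then have "F' x integrable_on cbox 0 1" by (simp add: integrable_continuous_real)
    then have "blinfun_apply (integral (cbox 0 1) (F' x)) v = integral (cbox 0 1) (\<lambda>t. blinfun_apply (F' x t) v)"
      by (rule blinfun_apply_integral)
    also have "\<dots> = integral {0..1} (\<lambda>t. frechet_derivative F (at (x, t)) (v, 0))"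
      using F' V by (auto intro!: integral_cong)
    finally show "blinfun_apply (integral (cbox 0 1) (F' x)) v =
      integral {0..1} (\<lambda>t. frechet_derivative F (at (x, t)) (v, 0))" .
  qed
  finally show ?thesis using e by (simp add: at_within_open[of x "ball x e"])
qed

text \<open>The derivative in direction \<open>v\<close> is again an integral of this form, with
  integrand the derivative of \<open>F\<close> in direction \<open>(v, 0)\<close>, so the order can
  be lowered step by step.\<close>

lemma Ck_on_integral_unit:
  fixes F :: "'a::euclidean_space \<times> real \<Rightarrow> real"
  assumes W: "V \<times> {0..1} \<subseteq> W" and V: "open V" and F: "Ck_on k W F"
  shows "Ck_on k V (\<lambda>x. integral {0..1} (\<lambda>t. F (x, t)))"
  using F
proof (induction k arbitrary: F)
  case 0
  then show ?case by (simp add: continuous_on_integral_unit continuous_on_subset[OF _ W])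
next
  case (Suc k)
  have "Ck_on (Suc 0) W F" using Ck_on_le[OF _ Suc.prems, of "Suc 0"] by simp
  note deriv = has_derivative_integral_unit[OF W V _ this]
  show ?case
    by (rule Ck_on_SucI[OF V deriv]) (use Suc in auto)
qed

section \<open>Dilations towards a base point in selected coordinates\<close>

text \<open>The radial homotopy of Poincare's lemma, restricted to the coordinates in
  \<open>D\<close>: time 0 projects to the slice through \<open>p\<close> that carries the initial
  values, time 1 is the identity. Point and time form one argument, so that smoothness is
  joint.\<close>

definition dilate :: "'n set \<Rightarrow> real^'n \<Rightarrow> (real^'n) \<times> real \<Rightarrow> real^'n" where
  "dilate D p z = (\<chi> j. if j \<in> D then p $ j + snd z * (fst z $ j - p $ j) else fst z $ j)"

lemma dilate_one [simp]: "dilate D p (r, 1) = r"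
  by (simp add: dilate_def vec_eq_iff)

text \<open>No coordinate moves away from \<open>p\<close>. Closed balls around \<open>p\<close> are
  thus preserved, which allows estimates on them to be iterated.\<close>

lemma dilate_mem_cball:
  assumes "r \<in> cball p \<rho>" "t \<in> {0..1}"
  shows "dilate D p (r, t) \<in> cball p \<rho>"
proof -
  have "norm (dilate D p (r, t) - p) \<le> norm (r - p)"
  proof (rule norm_le_componentwise_cart)
    fix j
    show "norm ((dilate D p (r, t) - p) $ j) \<le> norm ((r - p) $ j)"
      using assms(2) mult_right_mono[of t 1 "\<bar>r $ j - p $ j\<bar>"] by (auto simp: dilate_def abs_mult)
  qed
  then show ?thesis using assms(1) by (simp add: dist_norm norm_minus_commute)
qed

lemma dilate_mem_ball:
  assumes "r \<in> ball p \<delta>" "t \<in> {0..1}"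
  shows "dilate D p (r, t) \<in> ball p \<delta>"
  using dilate_mem_cball[of r p "dist p r" t D] assms by auto

lemma smooth_on_component: "open S \<Longrightarrow> smooth_on S f \<Longrightarrow> smooth_on S (\<lambda>x. f x $ i)"
  for f :: "'a::real_normed_vector \<Rightarrow> real^'n"
  by (rule smooth_on_bounded_linear[OF _ bounded_linear_vec_nth])

lemma smooth_on_dilate: "smooth_on UNIV (dilate D p)"
proof -
  have r: "smooth_on UNIV (\<lambda>z :: (real^'n) \<times> real. fst z $ j)" for j
    by (intro smooth_on_component smooth_on_linear bounded_linear_fst open_UNIV)
  have t: "smooth_on UNIV (\<lambda>z :: (real^'n) \<times> real. snd z)"
    by (intro smooth_on_linear bounded_linear_snd open_UNIV)
  have "smooth_on UNIV (\<lambda>z. if j \<in> D then p $ j + snd z * (fst z $ j - p $ j) else fst z $ j)" for j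
    by (cases "j \<in> D") (simp_all add: r t smooth_on_add smooth_on_mult smooth_on_diff smooth_on_const)
  then show ?thesis unfolding dilate_def[abs_def] by (intro smooth_on_vec) auto
qed

lemma has_derivative_dilate:
  "(dilate D p has_derivative
    (\<lambda>w. \<chi> j. if j \<in> D then snd w * (fst z $ j - p $ j) + snd z * (fst w $ j) else fst w $ j)) (at z)"
proof -
  have comp: "((\<lambda>z. if j \<in> D then p $ j + snd z * (fst z $ j - p $ j) else fst z $ j) has_derivative
     (\<lambda>w. if j \<in> D then snd w * (fst z $ j - p $ j) + snd z * (fst w $ j) else fst w $ j)) (at z)" for j
    by (cases "j \<in> D") (auto intro!: derivative_eq_intros bounded_linear.has_derivative[OF bounded_linear_vec_nth])
  show ?thesis
    unfolding dilate_def[abs_def]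
    by (subst has_derivative_componentwise_within)
      (auto simp: Basis_vec_def inner_axis intro!: comp)
qed

section \<open>Linear integral equations with dilated arguments\<close>

lemma linear_axis_expansion:
  fixes f :: "real^'n \<Rightarrow> 'b::real_vector"
  assumes "linear f"
  shows "f v = (\<Sum>l\<in>UNIV. v $ l *\<^sub>R f (axis l 1))"
proof -
  have "f v = f (\<Sum>l\<in>UNIV. v $ l *\<^sub>R axis l 1)"
    by (simp add: basis_expansion flip: scalar_mult_eq_scaleR)
  then show ?thesis using assms by (simp add: linear_sum linear_cmul)
qed

locale dilation_system =
  fixes p :: "real^'n" and \<delta> :: real and D :: "'m::finite \<Rightarrow> 'n set"
begin

text \<open>An open neighbourhood of the cylinder \<open>ball p \<delta> \<times> {0..1}\<close> on
  which functions given on the ball can still be composed with the dilation; it makes the end times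
  interior.\<close>

definition W :: "'m \<Rightarrow> ((real^'n) \<times> real) set" where
  "W \<alpha> = {z. fst z \<in> ball p \<delta> \<and> dilate (D \<alpha>) p z \<in> ball p \<delta>}"

text \<open>The kernel depends on point and time, not only on the dilated point: differentiation
  produces factors depending on time alone, and the class of equations \<open>u = s + T N u\<close>
  has to be closed under it.\<close>

definition integrand ::
  "('m \<Rightarrow> 'm \<Rightarrow> (real^'n) \<times> real \<Rightarrow> real) \<Rightarrow> ('m \<Rightarrow> real^'n \<Rightarrow> real) \<Rightarrow> 'm \<Rightarrow> (real^'n) \<times> real \<Rightarrow> real" where
  "integrand N u \<alpha> z = (\<Sum>\<beta>\<in>UNIV. N \<alpha> \<beta> z * u \<beta> (dilate (D \<alpha>) p z))"

definition T ::
  "('m \<Rightarrow> 'm \<Rightarrow> (real^'n) \<times> real \<Rightarrow> real) \<Rightarrow> ('m \<Rightarrow> real^'n \<Rightarrow> real) \<Rightarrow> 'm \<Rightarrow> real^'n \<Rightarrow> real" where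
  "T N u \<alpha> r = integral {0..1} (\<lambda>t. integrand N u \<alpha> (r, t))"

text \<open>The derivative of the \<open>l\<close>-th coordinate of the dilation with respect to
  \<open>r $ l\<close>.\<close>

definition scaling :: "'m \<Rightarrow> 'n \<Rightarrow> real \<Rightarrow> real" where
  "scaling \<alpha> l t = (if l \<in> D \<alpha> then t else 1)"

lemma continuous_on_dilate: "continuous_on S (dilate (D \<alpha>) p)"
  by (rule continuous_on_subset[OF smooth_on_continuous_on[OF smooth_on_dilate]]) simp

lemma open_W: "open (W \<alpha>)"
proof -
  have "W \<alpha> = fst -` ball p \<delta> \<inter> dilate (D \<alpha>) p -` ball p \<delta>" by (auto simp: W_def)
  moreover have "open (dilate (D \<alpha>) p -` ball p \<delta>)"
    by (rule open_vimage[OF open_ball continuous_on_dilate])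
  ultimately show ?thesis by (auto intro: open_vimage_fst)
qed

lemma cylinder_subset_W: "ball p \<delta> \<times> {0..1} \<subseteq> W \<alpha>"
  by (auto simp: W_def simp del: mem_ball intro: dilate_mem_ball)

lemma dilate_W: "dilate (D \<alpha>) p ` W \<alpha> \<subseteq> ball p \<delta>"
  by (auto simp: W_def)

lemma Ck_on_integrand:
  assumes "\<And>\<beta>. Ck_on k (W \<alpha>) (N \<alpha> \<beta>)" "\<And>\<beta>. Ck_on k (ball p \<delta>) (u \<beta>)"
  shows "Ck_on k (W \<alpha>) (integrand N u \<alpha>)"
proof -
  have "Ck_on k (W \<alpha>) (dilate (D \<alpha>) p)"
    using smooth_onD[OF smooth_on_dilate] by (rule Ck_on_subset) simp
  then show ?thesis
    unfolding integrand_def[abs_def]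
    by (intro Ck_on_sum open_W Ck_on_mult[OF open_W assms(1)] Ck_on_compose[OF open_W assms(2) _ dilate_W])
qed

lemma Ck_on_T:
  assumes "\<And>\<beta>. Ck_on k (W \<alpha>) (N \<alpha> \<beta>)" "\<And>\<beta>. Ck_on k (ball p \<delta>) (u \<beta>)"
  shows "Ck_on k (ball p \<delta>) (T N u \<alpha>)"
  unfolding T_def[abs_def]
  by (rule Ck_on_integral_unit[OF cylinder_subset_W open_ball Ck_on_integrand[of k \<alpha> N u, OF assms]])

lemma continuous_on_T:
  assumes "\<And>\<beta>. continuous_on (W \<alpha>) (N \<alpha> \<beta>)" "\<And>\<beta>. continuous_on (ball p \<delta>) (u \<beta>)"
  shows "continuous_on (ball p \<delta>) (T N u \<alpha>)"
  using Ck_on_T[of 0 \<alpha> N u] assms by simp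

lemma continuous_on_integrand:
  assumes "\<And>\<beta>. continuous_on (W \<alpha>) (N \<alpha> \<beta>)" "\<And>\<beta>. continuous_on (ball p \<delta>) (u \<beta>)" "r \<in> ball p \<delta>"
  shows "continuous_on {0..1} (\<lambda>t. integrand N u \<alpha> (r, t))"
proof (rule continuous_on_compose2[of "W \<alpha>" "integrand N u \<alpha>" "{0..1}" "\<lambda>t. (r, t)"])
  show "continuous_on (W \<alpha>) (integrand N u \<alpha>)"
    using Ck_on_integrand[of 0 \<alpha> N u] assms by simp
  show "continuous_on {0..1} (\<lambda>t. (r, t))" by (intro continuous_intros)
  show "(\<lambda>t. (r, t)) ` {0..1} \<subseteq> W \<alpha>" using cylinder_subset_W assms(3) by blast
qed

lemma T_add_diff:
  assumes "\<And>\<beta>. continuous_on (W \<alpha>) (N \<alpha> \<beta>)" "\<And>\<beta>. continuous_on (ball p \<delta>) (u \<beta>)"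
    "\<And>\<beta>. continuous_on (ball p \<delta>) (v \<beta>)" "r \<in> ball p \<delta>"
  shows "T N (\<lambda>\<beta> x. u \<beta> x + v \<beta> x) \<alpha> r = T N u \<alpha> r + T N v \<alpha> r"
    and "T N (\<lambda>\<beta> x. u \<beta> x - v \<beta> x) \<alpha> r = T N u \<alpha> r - T N v \<alpha> r"
proof -
  note int = continuous_on_integrand[of \<alpha> N _ r, OF assms(1) _ assms(4), THEN integrable_continuous_real]
  note int_u = int[of u, OF assms(2)] and int_v = int[of v, OF assms(3)]
  show "T N (\<lambda>\<beta> x. u \<beta> x + v \<beta> x) \<alpha> r = T N u \<alpha> r + T N v \<alpha> r"
    unfolding T_def integral_add[OF int_u int_v, symmetric]
    by (simp add: integrand_def distrib_left sum.distrib)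
  show "T N (\<lambda>\<beta> x. u \<beta> x - v \<beta> x) \<alpha> r = T N u \<alpha> r - T N v \<alpha> r"
    unfolding T_def integral_diff[OF int_u int_v, symmetric]
    by (simp add: integrand_def right_diff_distrib sum_subtractf)
qed

text \<open>A bound for \<open>u\<close> on the closed ball is enough, since dilated points do not
  leave it. The constant \<open>c\<close> bounds the row sums of the kernel.\<close>

lemma T_bound:
  assumes "\<And>\<beta>. continuous_on (W \<alpha>) (N \<alpha> \<beta>)" "\<And>\<beta>. continuous_on (ball p \<delta>) (u \<beta>)"
    and r: "r \<in> cball p \<rho>" "\<rho> < \<delta>"
    and u: "\<And>\<beta> x. x \<in> cball p \<rho> \<Longrightarrow> \<bar>u \<beta> x\<bar> \<le> b"
    and N: "\<And>t. t \<in> {0..1} \<Longrightarrow> (\<Sum>\<beta>\<in>UNIV. \<bar>N \<alpha> \<beta> (r, t)\<bar>) \<le> c"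
  shows "\<bar>T N u \<alpha> r\<bar> \<le> c * b"
proof -
  have rV: "r \<in> ball p \<delta>" using r by auto
  have "0 \<le> b" using u[OF r(1)] abs_ge_zero order_trans by blast
  have "norm (integrand N u \<alpha> (r, t)) \<le> c * b" if t: "t \<in> {0..1}" for t
  proof -
    have "norm (integrand N u \<alpha> (r, t)) \<le> (\<Sum>\<beta>\<in>UNIV. \<bar>N \<alpha> \<beta> (r, t)\<bar> * b)"
      unfolding integrand_def real_norm_def
      by (rule order_trans[OF sum_abs], rule sum_mono)
        (auto simp: abs_mult simp del: mem_cball intro!: mult_left_mono u dilate_mem_cball[OF r(1) t])
    also have "\<dots> \<le> c * b"
      unfolding sum_distrib_right[symmetric] by (rule mult_right_mono[OF N[OF t] \<open>0 \<le> b\<close>])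
    finally show ?thesis .
  qed
  from integral_bound[OF _ continuous_on_integrand[of \<alpha> N u r, OF assms(1,2) rV] this]
  show ?thesis by (simp add: T_def)
qed

text \<open>Functions continuous on the open ball may be unbounded there, so all estimates are made
  on compact balls of smaller radius. Finitely many indices share one bound.\<close>

lemma bounded_on_cball:
  fixes s :: "'i::finite \<Rightarrow> real^'n \<Rightarrow> real"
  assumes "\<And>\<alpha>. continuous_on (ball p \<delta>) (s \<alpha>)" "\<rho> < \<delta>"
  shows "\<exists>A\<ge>0. \<forall>\<alpha>. \<forall>x\<in>cball p \<rho>. \<bar>s \<alpha> x\<bar> \<le> A"
proof -
  have "\<exists>B. \<forall>x\<in>cball p \<rho>. \<bar>s \<alpha> x\<bar> \<le> B" for \<alpha>
  proof -
    have "compact (s \<alpha> ` cball p \<rho>)"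
      using assms by (intro compact_continuous_image continuous_on_subset[OF assms(1)]) auto
    then obtain B where "\<forall>y \<in> s \<alpha> ` cball p \<rho>. norm y \<le> B"
      using compact_imp_bounded bounded_iff by metis
    then show ?thesis by (intro exI[of _ B]) simp
  qed
  then obtain B where B: "\<And>\<alpha> x. x \<in> cball p \<rho> \<Longrightarrow> \<bar>s \<alpha> x\<bar> \<le> B \<alpha>" by metis
  have "\<bar>s \<alpha> x\<bar> \<le> (\<Sum>\<alpha>\<in>UNIV. \<bar>B \<alpha>\<bar>)" if "x \<in> cball p \<rho>" for \<alpha> x
    using B[OF that, of \<alpha>] member_le_sum[of \<alpha> UNIV "\<lambda>\<alpha>. \<bar>B \<alpha>\<bar>"] by auto
  then show ?thesis by (intro exI[of _ "\<Sum>\<alpha>\<in>UNIV. \<bar>B \<alpha>\<bar>"]) (simp add: sum_nonneg)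
qed

text \<open>The solution is the Neumann series \<open>s + T s + T\<^sup>2 s + \<dots>\<close>.\<close>

lemma ex_fixed_point:
  assumes N: "\<And>\<alpha> \<beta>. continuous_on (W \<alpha>) (N \<alpha> \<beta>)" and s: "\<And>\<alpha>. continuous_on (ball p \<delta>) (s \<alpha>)"
    and half: "\<And>\<alpha> r t. r \<in> ball p \<delta> \<Longrightarrow> t \<in> {0..1} \<Longrightarrow> (\<Sum>\<beta>\<in>UNIV. \<bar>N \<alpha> \<beta> (r, t)\<bar>) \<le> 1 / 2"
  obtains u where "\<And>\<alpha>. continuous_on (ball p \<delta>) (u \<alpha>)"
    "\<And>\<alpha> r. r \<in> ball p \<delta> \<Longrightarrow> u \<alpha> r = s \<alpha> r + T N u \<alpha> r"
proof -
  define d where "d = rec_nat s (\<lambda>_. T N)"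
  have d_simps: "d 0 = s" "d (Suc n) = T N (d n)" for n by (simp_all add: d_def)
  define S where "S n \<alpha> x = (\<Sum>i<n. d i \<alpha> x)" for n \<alpha> x
  define u where "u \<alpha> x = (\<Sum>i. d i \<alpha> x)" for \<alpha> x
  have d_cont: "continuous_on (ball p \<delta>) (d n \<alpha>)" for n \<alpha>
    by (induction n arbitrary: \<alpha>) (auto simp: d_simps intro: s continuous_on_T[OF N])
  have S_cont: "continuous_on (ball p \<delta>) (S n \<alpha>)" for n \<alpha>
    unfolding S_def[abs_def] by (intro continuous_on_sum d_cont)
  have S_Suc: "S (Suc n) \<alpha> x = s \<alpha> x + T N (S n) \<alpha> x" if "x \<in> ball p \<delta>" for n \<alpha> x
  proof (induction n)
    case 0
    then show ?case by (simp add: S_def d_simps T_def integrand_def)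
  next
    case (Suc n)
    have "S (Suc n) = (\<lambda>\<beta> x. S n \<beta> x + d n \<beta> x)" by (simp add: S_def fun_eq_iff)
    then have "T N (S (Suc n)) \<alpha> x = T N (S n) \<alpha> x + d (Suc n) \<alpha> x"
      using T_add_diff(1)[of \<alpha> N "S n" "d n" x, OF N S_cont d_cont that] by (simp add: d_simps)
    moreover have "S (Suc (Suc n)) \<alpha> x = S (Suc n) \<alpha> x + d (Suc n) \<alpha> x" by (simp add: S_def)
    ultimately show ?case using Suc by simp
  qed
  have lim: "uniform_limit (cball p \<rho>) (\<lambda>n. S n \<alpha>) (u \<alpha>) sequentially" if \<rho>: "\<rho> < \<delta>" for \<rho> \<alpha>
  proof -
    obtain A where A: "A \<ge> 0" "\<And>\<alpha> x. x \<in> cball p \<rho> \<Longrightarrow> \<bar>s \<alpha> x\<bar> \<le> A"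
      using bounded_on_cball[of s \<rho>, OF s \<rho>] by auto
    have "\<bar>d n \<alpha> x\<bar> \<le> (1/2)^n * A" if "x \<in> cball p \<rho>" for n \<alpha> x
      using that
    proof (induction n arbitrary: x \<alpha>)
      case 0
      then show ?case using A by (simp add: d_simps)
    next
      case (Suc n)
      have "x \<in> ball p \<delta>" using Suc.prems \<rho> by auto
      then have "\<bar>T N (d n) \<alpha> x\<bar> \<le> 1/2 * ((1/2)^n * A)"
        using half by (intro T_bound[where \<rho> = \<rho>] N d_cont Suc.prems \<rho> Suc.IH)
      then show ?case by (simp add: d_simps)
    qed
    then show ?thesis
      unfolding S_def[abs_def] u_def[abs_def]
      by (intro Weierstrass_m_test[where M = "\<lambda>n. (1/2)^n * A"]) (auto intro: summable_mult2)
  qed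
  have u_cont: "continuous_on (ball p \<delta>) (u \<alpha>)" for \<alpha>
  proof (rule continuous_at_imp_continuous_on, rule ballI)
    fix x assume "x \<in> ball p \<delta>"
    then obtain \<rho> where \<rho>: "dist p x < \<rho>" "\<rho> < \<delta>" using dense by auto
    have "continuous_on (cball p \<rho>) (u \<alpha>)"
      by (rule uniform_limit_theorem[OF _ lim[OF \<rho>(2)]])
        (use \<rho> in \<open>auto intro!: always_eventually continuous_on_subset[OF S_cont]\<close>)
    then show "isCont (u \<alpha>) x"
      using \<rho> by (intro continuous_on_interior[of "cball p \<rho>"]) auto
  qed
  have "u \<alpha> r = s \<alpha> r + T N u \<alpha> r" if r: "r \<in> ball p \<delta>" for \<alpha> r
  proof -
    define \<rho> where "\<rho> = dist p r"
    have \<rho>: "\<rho> < \<delta>" and rc: "r \<in> cball p \<rho>" using r by (auto simp: \<rho>_def)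
    \<comment> \<open>The value of the operator at \<open>r\<close> involves only the closed ball
      through \<open>r\<close>, where the partial sums converge uniformly.\<close>
    have "(\<lambda>n. T N (S n) \<alpha> r) \<longlonglongrightarrow> T N u \<alpha> r"
    proof (rule metric_LIMSEQ_I)
      fix e :: real assume "e > 0"
      then have "\<forall>\<^sub>F n in sequentially. \<forall>\<beta>. \<forall>x\<in>cball p \<rho>. dist (S n \<beta> x) (u \<beta> x) < e"
        using uniform_limitD[OF lim[OF \<rho>]] by (simp add: eventually_all_finite)
      then obtain n0 where n0: "\<And>n \<beta> x. n \<ge> n0 \<Longrightarrow> x \<in> cball p \<rho> \<Longrightarrow> dist (S n \<beta> x) (u \<beta> x) < e"
        unfolding eventually_sequentially by blast
      have "dist (T N (S n) \<alpha> r) (T N u \<alpha> r) < e" if "n \<ge> n0" for n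
      proof -
        have "\<bar>T N (\<lambda>\<beta> x. S n \<beta> x - u \<beta> x) \<alpha> r\<bar> \<le> 1/2 * e"
          using n0[OF that] half[OF r]
          by (intro T_bound[where \<rho> = \<rho>] N continuous_on_diff S_cont u_cont rc \<rho>)
              (simp_all add: dist_real_def less_imp_le)
        then show ?thesis
          using T_add_diff(2)[of \<alpha> N "S n" u r, OF N S_cont u_cont r] \<open>e > 0\<close> by (simp add: dist_real_def)
      qed
      then show "\<exists>n0. \<forall>n\<ge>n0. dist (T N (S n) \<alpha> r) (T N u \<alpha> r) < e" by blast
    qed
    then have "(\<lambda>n. S (Suc n) \<alpha> r) \<longlonglongrightarrow> s \<alpha> r + T N u \<alpha> r"
      unfolding S_Suc[OF r] by (intro tendsto_intros)
    moreover have "(\<lambda>n. S (Suc n) \<alpha> r) \<longlonglongrightarrow> u \<alpha> r"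
      using LIMSEQ_Suc[OF tendsto_uniform_limitI[OF lim[OF \<rho>] rc]] .
    ultimately show ?thesis by (rule LIMSEQ_unique[rotated])
  qed
  with u_cont show ?thesis using that by blast
qed

section \<open>Differentiability of the fixed points\<close>

text \<open>By the product rule, differentiating \<open>T N u\<close> along coordinate
  \<open>l\<close> hits either the kernel, which gives \<open>kernel_deriv\<close>, or the unknown
  at the dilated point, where the chain rule gives \<open>kernel_scaled\<close> acting on the
  derivative of the unknown.\<close>

definition kernel_deriv ::
  "'n \<Rightarrow> ('m \<Rightarrow> 'm \<Rightarrow> (real^'n) \<times> real \<Rightarrow> real) \<Rightarrow> 'm \<Rightarrow> 'm \<Rightarrow> (real^'n) \<times> real \<Rightarrow> real" where
  "kernel_deriv l N \<alpha> \<beta> z = frechet_derivative (N \<alpha> \<beta>) (at z) (axis l 1, 0)"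

definition kernel_scaled ::
  "'n \<Rightarrow> ('m \<Rightarrow> 'm \<Rightarrow> (real^'n) \<times> real \<Rightarrow> real) \<Rightarrow> 'm \<Rightarrow> 'm \<Rightarrow> (real^'n) \<times> real \<Rightarrow> real" where
  "kernel_scaled l N \<alpha> \<beta> z = N \<alpha> \<beta> z * scaling \<alpha> l (snd z)"

definition deriv_along :: "'n \<Rightarrow> ('m \<Rightarrow> real^'n \<Rightarrow> real) \<Rightarrow> 'm \<Rightarrow> real^'n \<Rightarrow> real" where
  "deriv_along l u \<alpha> x = frechet_derivative (u \<alpha>) (at x) (axis l 1)"

lemma smooth_on_scaling: "smooth_on S (\<lambda>z. scaling \<alpha> l (snd z))" if "open S"
  for S :: "((real^'n) \<times> real) set"
  using that by (cases "l \<in> D \<alpha>") (simp_all add: scaling_def smooth_on_linear bounded_linear_snd smooth_on_const)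

lemma smooth_on_kernel_deriv: "smooth_on S (N \<alpha> \<beta>) \<Longrightarrow> smooth_on S (kernel_deriv l N \<alpha> \<beta>)"
  unfolding kernel_deriv_def[abs_def] by (rule smooth_on_frechet_derivative)

lemma smooth_on_kernel_scaled: "smooth_on S (N \<alpha> \<beta>) \<Longrightarrow> open S \<Longrightarrow> smooth_on S (kernel_scaled l N \<alpha> \<beta>)"
  unfolding kernel_scaled_def[abs_def] by (intro smooth_on_mult smooth_on_scaling)

text \<open>The factor from the chain rule is at most 1, so the differentiated equation contracts on
  the same ball. This is why the ball need not shrink with the order of differentiation.\<close>

lemma row_sum_kernel_scaled:
  assumes "(\<Sum>\<beta>\<in>UNIV. \<bar>N \<alpha> \<beta> (r, t)\<bar>) \<le> c" "t \<in> {0..1}"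
  shows "(\<Sum>\<beta>\<in>UNIV. \<bar>kernel_scaled l N \<alpha> \<beta> (r, t)\<bar>) \<le> c"
proof -
  have "\<bar>scaling \<alpha> l t\<bar> \<le> 1" using assms(2) by (auto simp: scaling_def)
  then have "\<bar>kernel_scaled l N \<alpha> \<beta> (r, t)\<bar> \<le> \<bar>N \<alpha> \<beta> (r, t)\<bar>" for \<beta>
    by (simp add: kernel_scaled_def abs_mult mult_left_le)
  then show ?thesis using assms(1) sum_mono order_trans by meson
qed

lemma frechet_derivative_integrand:
  assumes N: "\<And>\<beta>. Ck_on (Suc 0) (W \<alpha>) (N \<alpha> \<beta>)" and u: "\<And>\<beta>. Ck_on (Suc 0) (ball p \<delta>) (u \<beta>)"
    and z: "z \<in> W \<alpha>"
  shows "frechet_derivative (integrand N u \<alpha>) (at z) (axis l 1, 0) =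
    integrand (kernel_deriv l N) u \<alpha> z + integrand (kernel_scaled l N) (deriv_along l u) \<alpha> z"
proof -
  let ?d = "dilate (D \<alpha>) p"
  let ?d' = "\<lambda>w. \<chi> j. if j \<in> D \<alpha> then snd w * (fst z $ j - p $ j) + snd z * (fst w $ j) else fst w $ j"
  have dz: "?d z \<in> ball p \<delta>" using z by (simp add: W_def)
  have "(integrand N u \<alpha> has_derivative (\<lambda>w. \<Sum>\<beta>\<in>UNIV.
      N \<alpha> \<beta> z * frechet_derivative (u \<beta>) (at (?d z)) (?d' w)
      + frechet_derivative (N \<alpha> \<beta>) (at z) w * u \<beta> (?d z))) (at z)"
    unfolding integrand_def[abs_def]
    by (intro has_derivative_sum has_derivative_mult Ck_on_Suc_has_derivative[OF N z]
        has_derivative_compose[OF has_derivative_dilate Ck_on_Suc_has_derivative[OF u dz]])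
  from frechet_derivative_at[OF this, symmetric]
  have "frechet_derivative (integrand N u \<alpha>) (at z) (axis l 1, 0) = (\<Sum>\<beta>\<in>UNIV.
      N \<alpha> \<beta> z * frechet_derivative (u \<beta>) (at (?d z)) (?d' (axis l 1, 0))
      + frechet_derivative (N \<alpha> \<beta>) (at z) (axis l 1, 0) * u \<beta> (?d z))" by simp
  moreover have "?d' (axis l 1, 0) = scaling \<alpha> l (snd z) *\<^sub>R axis l 1"
    by (auto simp: vec_eq_iff scaling_def axis_def)
  moreover have "frechet_derivative (u \<beta>) (at (?d z)) (c *\<^sub>R axis l 1) =
      c * frechet_derivative (u \<beta>) (at (?d z)) (axis l 1)" for \<beta> c
    using linear_cmul[OF has_derivative_linear[OF Ck_on_Suc_has_derivative[OF u dz]]] by simp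
  ultimately show ?thesis
    by (simp add: integrand_def kernel_deriv_def kernel_scaled_def deriv_along_def sum.distrib algebra_simps)
qed

text \<open>The first term contains only the undifferentiated function and acts as a source; the
  second has the form of the original operator.\<close>

lemma deriv_along_T:
  assumes N: "\<And>\<beta>. Ck_on (Suc 0) (W \<alpha>) (N \<alpha> \<beta>)" and u: "\<And>\<beta>. Ck_on (Suc 0) (ball p \<delta>) (u \<beta>)"
    and r: "r \<in> ball p \<delta>"
  shows "deriv_along l (T N u) \<alpha> r = T (kernel_deriv l N) u \<alpha> r + T (kernel_scaled l N) (deriv_along l u) \<alpha> r"
proof -
  have "frechet_derivative (T N u \<alpha>) (at r) =
      (\<lambda>v. integral {0..1} (\<lambda>t. frechet_derivative (integrand N u \<alpha>) (at (r, t)) (v, 0)))"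
    unfolding T_def[abs_def]
    by (rule frechet_derivative_at[symmetric, OF has_derivative_integral_unit[OF cylinder_subset_W open_ball r]],
      rule Ck_on_integrand[of _ \<alpha> N u, OF N u])
  then have "deriv_along l (T N u) \<alpha> r =
      integral {0..1} (\<lambda>t. frechet_derivative (integrand N u \<alpha>) (at (r, t)) (axis l 1, 0))"
    by (simp add: deriv_along_def)
  also have "\<dots> = integral {0..1} (\<lambda>t. integrand (kernel_deriv l N) u \<alpha> (r, t)
      + integrand (kernel_scaled l N) (deriv_along l u) \<alpha> (r, t))"
  proof (rule integral_cong)
    fix t :: real assume "t \<in> {0..1}"
    then have "(r, t) \<in> W \<alpha>" using cylinder_subset_W r by blast
    then show "frechet_derivative (integrand N u \<alpha>) (at (r, t)) (axis l 1, 0) =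
        integrand (kernel_deriv l N) u \<alpha> (r, t) + integrand (kernel_scaled l N) (deriv_along l u) \<alpha> (r, t)"
      by (rule frechet_derivative_integrand[of \<alpha> N u, OF N u])
  qed
  also have "\<dots> = T (kernel_deriv l N) u \<alpha> r + T (kernel_scaled l N) (deriv_along l u) \<alpha> r"
    unfolding T_def
  proof (intro integral_add integrable_continuous_real continuous_on_integrand r)
    fix \<beta>
    show "continuous_on (W \<alpha>) (kernel_deriv l N \<alpha> \<beta>)"
      using N[of \<beta>] by (simp add: kernel_deriv_def[abs_def])
    show "continuous_on (ball p \<delta>) (u \<beta>)" using u by (rule Ck_on_continuous_on)
    show "continuous_on (W \<alpha>) (kernel_scaled l N \<alpha> \<beta>)"
      unfolding kernel_scaled_def[abs_def]
      by (intro continuous_on_mult Ck_on_continuous_on[OF N] smooth_on_continuous_on[OF smooth_on_scaling] open_W)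
    show "continuous_on (ball p \<delta>) (deriv_along l u \<beta>)"
      using u[of \<beta>] by (simp add: deriv_along_def[abs_def])
  qed
  finally show ?thesis .
qed

text \<open>Meant for \<open>kernel_deriv\<close>, which need not be contracting: it is applied to
  differences that already decay geometrically, so any bound will do.\<close>

lemma kernel_bounded_on_cball:
  fixes N :: "'m \<Rightarrow> 'm \<Rightarrow> (real^'n) \<times> real \<Rightarrow> real"
  assumes N: "\<And>\<beta>. continuous_on (W \<alpha>) (N \<alpha> \<beta>)" and \<rho>: "\<rho> < \<delta>"
  shows "\<exists>K\<ge>0. \<forall>r\<in>cball p \<rho>. \<forall>t\<in>{0..1}. (\<Sum>\<beta>\<in>UNIV. \<bar>N \<alpha> \<beta> (r, t)\<bar>) \<le> K"
proof -
  have sub: "cball p \<rho> \<times> {0..1} \<subseteq> W \<alpha>" using cylinder_subset_W \<rho> by (fastforce simp: subset_iff)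
  have "continuous_on (cball p \<rho> \<times> {0..1}) (\<lambda>z. \<Sum>\<beta>\<in>UNIV. \<bar>N \<alpha> \<beta> z\<bar>)"
    by (intro continuous_on_sum continuous_on_rabs continuous_on_subset[OF N sub])
  then have "compact ((\<lambda>z. \<Sum>\<beta>\<in>UNIV. \<bar>N \<alpha> \<beta> z\<bar>) ` (cball p \<rho> \<times> {0..1}))"
    by (rule compact_continuous_image) (intro compact_Times compact_cball compact_Icc)
  then obtain K where K: "\<forall>y\<in>(\<lambda>z. \<Sum>\<beta>\<in>UNIV. \<bar>N \<alpha> \<beta> z\<bar>) ` (cball p \<rho> \<times> {0..1}). norm y \<le> K"
    using compact_imp_bounded bounded_iff by metis
  then have "(\<Sum>\<beta>\<in>UNIV. \<bar>N \<alpha> \<beta> (r, t)\<bar>) \<le> \<bar>K\<bar>" if "r \<in> cball p \<rho>" "t \<in> {0..1}" for r t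
    using that by (force simp del: mem_cball)
  then show ?thesis by (intro exI[of _ "\<bar>K\<bar>"]) auto
qed

text \<open>
  The derivatives of the Picard iterates converge to the fixed points \<open>w l\<close> of the formally
  differentiated equations.
\<close>

lemma fixed_point_C1:
  assumes N: "\<And>\<alpha> \<beta>. Ck_on (Suc 0) (W \<alpha>) (N \<alpha> \<beta>)" and s: "\<And>\<alpha>. Ck_on (Suc 0) (ball p \<delta>) (s \<alpha>)"
    and half: "\<And>\<alpha> r t. r \<in> ball p \<delta> \<Longrightarrow> t \<in> {0..1} \<Longrightarrow> (\<Sum>\<beta>\<in>UNIV. \<bar>N \<alpha> \<beta> (r, t)\<bar>) \<le> 1 / 2"
    and u: "\<And>\<alpha>. continuous_on (ball p \<delta>) (u \<alpha>)"
    and u_eq: "\<And>\<alpha> r. r \<in> ball p \<delta> \<Longrightarrow> u \<alpha> r = s \<alpha> r + T N u \<alpha> r"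
    and w: "\<And>l \<alpha>. continuous_on (ball p \<delta>) (w l \<alpha>)"
    and w_eq: "\<And>l \<alpha> r. r \<in> ball p \<delta> \<Longrightarrow>
      w l \<alpha> r = (deriv_along l s \<alpha> r + T (kernel_deriv l N) u \<alpha> r) + T (kernel_scaled l N) (w l) \<alpha> r"
    and x: "x \<in> ball p \<delta>"
  shows "(u \<alpha> has_derivative (\<lambda>v. \<Sum>l\<in>UNIV. v $ l * w l \<alpha> x)) (at x)"
proof -
  define v where "v = rec_nat (\<lambda>_ _. 0) (\<lambda>_ f \<alpha> r. s \<alpha> r + T N f \<alpha> r)"
  have v_simps: "v 0 = (\<lambda>_ _. 0)" "v (Suc n) = (\<lambda>\<alpha> r. s \<alpha> r + T N (v n) \<alpha> r)" for n
    by (simp_all add: v_def)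
  have v: "Ck_on (Suc 0) (ball p \<delta>) (v n \<alpha>)" for n \<alpha>
  proof (induction n arbitrary: \<alpha>)
    case 0
    then show ?case unfolding v_simps by (rule Ck_on_const)
  next
    case (Suc n)
    then show ?case unfolding v_simps by (intro Ck_on_add open_ball s Ck_on_T N)
  qed
  note v_cont = Ck_on_continuous_on[OF v] and N_cont = Ck_on_continuous_on[OF N]
  have ND: "continuous_on (W \<alpha>) (kernel_deriv l N \<alpha> \<beta>)" for \<alpha> \<beta> l
    using N[of \<alpha> \<beta>] by (simp add: kernel_deriv_def[abs_def])
  have NS: "continuous_on (W \<alpha>) (kernel_scaled l N \<alpha> \<beta>)" for \<alpha> \<beta> l
    unfolding kernel_scaled_def[abs_def]
    by (intro continuous_on_mult N_cont smooth_on_continuous_on[OF smooth_on_scaling] open_W)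
  have vD: "continuous_on (ball p \<delta>) (deriv_along l (v n) \<alpha>)" for l n \<alpha>
    using v[of n \<alpha>] by (simp add: deriv_along_def[abs_def])
  obtain \<rho> where \<rho>: "dist p x < \<rho>" "\<rho> < \<delta>" using x dense by auto
  have sub: "r \<in> ball p \<delta>" if "r \<in> cball p \<rho>" for r using that \<rho> by auto
  obtain A where A: "A \<ge> 0" "\<And>\<alpha> r. r \<in> cball p \<rho> \<Longrightarrow> \<bar>u \<alpha> r\<bar> \<le> A"
    using bounded_on_cball[of u \<rho>, OF u \<rho>(2)] by auto
  have "\<forall>l. \<exists>B\<ge>0. \<forall>\<alpha>. \<forall>r\<in>cball p \<rho>. \<bar>w l \<alpha> r\<bar> \<le> B"
    using bounded_on_cball[of "w _" \<rho>, OF w \<rho>(2)] by blast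
  then obtain B0 where B0: "\<And>l. B0 l \<ge> 0" "\<And>l \<alpha> r. r \<in> cball p \<rho> \<Longrightarrow> \<bar>w l \<alpha> r\<bar> \<le> B0 l" by metis
  have "\<forall>l \<alpha>. \<exists>K\<ge>0. \<forall>r\<in>cball p \<rho>. \<forall>t\<in>{0..1}. (\<Sum>\<beta>\<in>UNIV. \<bar>kernel_deriv l N \<alpha> \<beta> (r, t)\<bar>) \<le> K"
    using kernel_bounded_on_cball[of _ "kernel_deriv _ N", OF ND \<rho>(2)] by blast
  then obtain K0 where K0: "\<And>l \<alpha>. K0 l \<alpha> \<ge> 0" "\<And>l \<alpha> r t. r \<in> cball p \<rho> \<Longrightarrow> t \<in> {0..1} \<Longrightarrow>
    (\<Sum>\<beta>\<in>UNIV. \<bar>kernel_deriv l N \<alpha> \<beta> (r, t)\<bar>) \<le> K0 l \<alpha>" by metis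
  define K where "K l = (\<Sum>\<alpha>\<in>UNIV. K0 l \<alpha>)" for l
  have K: "K l \<ge> 0" "r \<in> cball p \<rho> \<Longrightarrow> t \<in> {0..1} \<Longrightarrow> (\<Sum>\<beta>\<in>UNIV. \<bar>kernel_deriv l N \<alpha> \<beta> (r, t)\<bar>) \<le> K l" for l \<alpha> r t
  proof -
    show "K l \<ge> 0" unfolding K_def by (intro sum_nonneg K0)
    show "(\<Sum>\<beta>\<in>UNIV. \<bar>kernel_deriv l N \<alpha> \<beta> (r, t)\<bar>) \<le> K l" if "r \<in> cball p \<rho>" "t \<in> {0..1}"
      using K0(2)[OF that] member_le_sum[of \<alpha> UNIV "K0 l"] K0(1) unfolding K_def
      by (meson UNIV_I finite order_trans)
  qed
  \<comment> \<open>The derivative errors \<open>e n\<close> satisfy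
    \<open>e (Suc n) \<le> K l * A * (1/2)^n + e n / 2\<close>. The rate 3/4, slower than 1/2,
    absorbs the source: \<open>4 * K l * A \<le> B l\<close> bounds it by a quarter of
    \<open>B l * (3/4)^n\<close>, and 1/4 + 1/2 = 3/4. The summand \<open>B0 l\<close> covers
    \<open>n = 0\<close>.\<close>
  define B where "B l = B0 l + 4 * K l * A" for l
  have uv: "\<bar>v n \<alpha> r - u \<alpha> r\<bar> \<le> A * (1/2)^n" if "r \<in> cball p \<rho>" for n \<alpha> r
    using that
  proof (induction n arbitrary: \<alpha> r)
    case 0
    then show ?case using A by (simp add: v_simps del: mem_cball)
  next
    case (Suc n)
    have "\<bar>T N (\<lambda>\<beta> y. v n \<beta> y - u \<beta> y) \<alpha> r\<bar> \<le> 1/2 * (A * (1/2)^n)"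
      using half[OF sub[OF Suc.prems]]
      by (intro T_bound[where \<rho> = \<rho>] N_cont continuous_on_diff v_cont u Suc \<rho>)
    moreover have "v (Suc n) \<alpha> r - u \<alpha> r = T N (\<lambda>\<beta> y. v n \<beta> y - u \<beta> y) \<alpha> r"
      using T_add_diff(2)[of \<alpha> N "v n" u r, OF N_cont v_cont u] sub[OF Suc.prems] u_eq
      by (simp add: v_simps del: mem_ball)
    ultimately show ?case by simp
  qed
  have wv: "\<bar>deriv_along l (v n) \<alpha> r - w l \<alpha> r\<bar> \<le> B l * (3/4)^n" if "r \<in> cball p \<rho>" for n \<alpha> r l
    using that
  proof (induction n arbitrary: \<alpha> r)
    case 0
    have "deriv_along l (v 0) \<alpha> r = 0" by (simp add: deriv_along_def v_simps frechet_derivative_const)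
    then show ?case using B0(2)[OF 0] A K(1)[of l] by (simp add: B_def add_increasing2)
  next
    case (Suc n)
    note r = sub[OF Suc.prems]
    have "(deriv_along l (v (Suc n)) \<alpha> r) = deriv_along l s \<alpha> r + deriv_along l (T N (v n)) \<alpha> r"
      unfolding deriv_along_def v_simps
      using frechet_derivative_at[symmetric, OF has_derivative_add[OF Ck_on_Suc_has_derivative[OF s r]
        Ck_on_Suc_has_derivative[OF Ck_on_T[of _ _ N "v n", OF N v] r]]] by simp
    also have "\<dots> = deriv_along l s \<alpha> r + (T (kernel_deriv l N) (v n) \<alpha> r + T (kernel_scaled l N) (deriv_along l (v n)) \<alpha> r)"
      using deriv_along_T[of \<alpha> N "v n" r l, OF N v r] by simp
    finally have "deriv_along l (v (Suc n)) \<alpha> r - w l \<alpha> r =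
        T (kernel_deriv l N) (\<lambda>\<beta> y. v n \<beta> y - u \<beta> y) \<alpha> r
        + T (kernel_scaled l N) (\<lambda>\<beta> y. deriv_along l (v n) \<beta> y - w l \<beta> y) \<alpha> r"
      using T_add_diff(2)[of \<alpha> "kernel_deriv l N" "v n" u r, OF ND v_cont u r]
        T_add_diff(2)[of \<alpha> "kernel_scaled l N" "deriv_along l (v n)" "w l" r, OF NS vD w r] w_eq[OF r, of l \<alpha>]
      by simp
    moreover have "\<bar>T (kernel_deriv l N) (\<lambda>\<beta> y. v n \<beta> y - u \<beta> y) \<alpha> r\<bar> \<le> K l * (A * (1/2)^n)"
      by (intro T_bound[where \<rho> = \<rho>] ND continuous_on_diff v_cont u \<rho> uv K(2) Suc.prems)
    moreover have "\<bar>T (kernel_scaled l N) (\<lambda>\<beta> y. deriv_along l (v n) \<beta> y - w l \<beta> y) \<alpha> r\<bar> \<le> 1/2 * (B l * (3/4)^n)"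
      by (intro T_bound[where \<rho> = \<rho>] NS continuous_on_diff vD w \<rho> Suc row_sum_kernel_scaled half r)
    moreover have "K l * (A * (1/2)^n) \<le> B l / 4 * (3/4)^n"
    proof -
      have "(1/2::real)^n \<le> (3/4)^n" by (rule power_mono) auto
      then have "K l * A * (1/2)^n \<le> K l * A * (3/4)^n"
        using K(1) A(1) by (intro mult_left_mono) auto
      also have "\<dots> \<le> B l / 4 * (3/4)^n"
        using B0(1)[of l] by (intro mult_right_mono) (auto simp: B_def)
      finally show ?thesis by (simp add: mult.assoc)
    qed
    ultimately have "\<bar>deriv_along l (v (Suc n)) \<alpha> r - w l \<alpha> r\<bar> \<le> B l / 4 * (3/4)^n + 1/2 * (B l * (3/4)^n)"
      by linarith
    then show ?case by simp
  qed
  have vu_lim: "(\<lambda>n. v n \<alpha> y) \<longlonglongrightarrow> u \<alpha> y" if "y \<in> ball p \<rho>" for y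
  proof -
    have "(\<lambda>n. A * (1/2)^n) \<longlonglongrightarrow> 0" by (intro tendsto_mult_right_zero LIMSEQ_realpow_zero) auto
    moreover have "\<forall>\<^sub>F n in sequentially. norm (v n \<alpha> y - u \<alpha> y) \<le> A * (1/2)^n"
      using uv that by (intro always_eventually) simp
    ultimately have "(\<lambda>n. v n \<alpha> y - u \<alpha> y) \<longlonglongrightarrow> 0"
      by (rule Lim_null_comparison[rotated])
    then show ?thesis by (rule Lim_null[THEN iffD2])
  qed
  define C where "C = (\<Sum>l\<in>UNIV. B l)"
  have "\<exists>g. \<forall>y\<in>ball p \<rho>. (\<lambda>n. v n \<alpha> y) \<longlonglongrightarrow> g y \<and>
      (g has_derivative (\<lambda>h. \<Sum>l\<in>UNIV. h $ l * w l \<alpha> y)) (at y within ball p \<rho>)"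
  proof (rule has_derivative_sequence[OF convex_ball])
    show "(v n \<alpha> has_derivative (\<lambda>h. \<Sum>l\<in>UNIV. h $ l * deriv_along l (v n) \<alpha> y)) (at y within ball p \<rho>)"
      if "y \<in> ball p \<rho>" for n y
    proof -
      have "y \<in> ball p \<delta>" using that sub by auto
      note d = Ck_on_Suc_has_derivative[OF v[of n \<alpha>] this]
      have "frechet_derivative (v n \<alpha>) (at y) = (\<lambda>h. \<Sum>l\<in>UNIV. h $ l * deriv_along l (v n) \<alpha> y)"
        unfolding deriv_along_def real_scaleR_def[symmetric]
        by (rule ext, rule linear_axis_expansion[OF has_derivative_linear[OF d]])
      then show ?thesis using has_derivative_at_withinI[OF d] by simp
    qed
    show "\<forall>\<^sub>F n in sequentially. \<forall>y\<in>ball p \<rho>. \<forall>h.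
        norm ((\<Sum>l\<in>UNIV. h $ l * deriv_along l (v n) \<alpha> y) - (\<Sum>l\<in>UNIV. h $ l * w l \<alpha> y)) \<le> e * norm h"
      if "e > 0" for e
    proof -
      have "(\<lambda>n. C * (3/4)^n) \<longlonglongrightarrow> 0" by (intro tendsto_mult_right_zero LIMSEQ_realpow_zero) auto
      then have "\<forall>\<^sub>F n in sequentially. C * (3/4)^n < e" using that by (rule order_tendstoD)
      then show ?thesis
      proof eventually_elim
        case (elim n)
        show ?case
        proof (intro ballI allI)
          fix y h assume "y \<in> ball p \<rho>"
          then have y: "y \<in> cball p \<rho>" by simp
          have "norm ((\<Sum>l\<in>UNIV. h $ l * deriv_along l (v n) \<alpha> y) - (\<Sum>l\<in>UNIV. h $ l * w l \<alpha> y))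
              \<le> (\<Sum>l\<in>UNIV. \<bar>h $ l\<bar> * \<bar>deriv_along l (v n) \<alpha> y - w l \<alpha> y\<bar>)"
            unfolding sum_subtractf[symmetric] right_diff_distrib[symmetric] real_norm_def
            by (rule order_trans[OF sum_abs]) (simp add: abs_mult)
          also have "\<dots> \<le> (\<Sum>l\<in>UNIV. norm h * (B l * (3/4)^n))"
            by (intro sum_mono mult_mono component_le_norm_cart wv y) auto
          also have "\<dots> = C * (3/4)^n * norm h"
            by (simp add: C_def sum_distrib_left sum_distrib_right mult_ac)
          also have "\<dots> \<le> e * norm h" using elim by (intro mult_right_mono) auto
          finally show "norm ((\<Sum>l\<in>UNIV. h $ l * deriv_along l (v n) \<alpha> y) - (\<Sum>l\<in>UNIV. h $ l * w l \<alpha> y)) \<le> e * norm h" .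
        qed
      qed
    qed
    show "x \<in> ball p \<rho>" using \<rho> by simp
    then show "(\<lambda>n. v n \<alpha> x) \<longlonglongrightarrow> u \<alpha> x" using vu_lim by simp
  qed
  then obtain g where g: "\<And>y. y \<in> ball p \<rho> \<Longrightarrow> (\<lambda>n. v n \<alpha> y) \<longlonglongrightarrow> g y"
    "\<And>y. y \<in> ball p \<rho> \<Longrightarrow> (g has_derivative (\<lambda>h. \<Sum>l\<in>UNIV. h $ l * w l \<alpha> y)) (at y within ball p \<rho>)"
    by blast
  have "g y = u \<alpha> y" if "y \<in> ball p \<rho>" for y
    using g(1)[OF that] vu_lim[OF that] LIMSEQ_unique by blast
  moreover have x: "x \<in> ball p \<rho>" using \<rho> by simp
  then have "(g has_derivative (\<lambda>h. \<Sum>l\<in>UNIV. h $ l * w l \<alpha> x)) (at x)"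
    using g(2)[OF x] by (simp only: at_within_open[OF x open_ball])
  ultimately show ?thesis
    using has_derivative_transform_within_open[OF _ open_ball x] by blast
qed

text \<open>Induction over all equations at once. If \<open>u\<close> is of order \<open>k\<close>,
  then so is the source of the differentiated equation; its solutions \<open>w l\<close> are of
  order \<open>k\<close> by the induction hypothesis applied to that equation, and
  \<open>fixed_point_C1\<close> identifies them as the partial derivatives of \<open>u\<close>.
  Kernels are assumed smooth because each step differentiates them.\<close>

lemma fixed_point_Ck:
  assumes "\<And>\<alpha> \<beta>. smooth_on (W \<alpha>) (N \<alpha> \<beta>)" and "\<And>\<alpha>. Ck_on k (ball p \<delta>) (s \<alpha>)"
    and "\<And>\<alpha> r t. r \<in> ball p \<delta> \<Longrightarrow> t \<in> {0..1} \<Longrightarrow> (\<Sum>\<beta>\<in>UNIV. \<bar>N \<alpha> \<beta> (r, t)\<bar>) \<le> 1 / 2"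
    and "\<And>\<alpha>. continuous_on (ball p \<delta>) (u \<alpha>)"
    and "\<And>\<alpha> r. r \<in> ball p \<delta> \<Longrightarrow> u \<alpha> r = s \<alpha> r + T N u \<alpha> r"
  shows "Ck_on k (ball p \<delta>) (u \<alpha>)"
  using assms
proof (induction k arbitrary: N s u \<alpha>)
  case 0
  then show ?case by simp
next
  case (Suc k)
  note N = Suc.prems(1) and s = Suc.prems(2) and half = Suc.prems(3) and u = Suc.prems(4) and u_eq = Suc.prems(5)
  have uk: "Ck_on k (ball p \<delta>) (u \<alpha>)" for \<alpha>
    by (rule Suc.IH[OF N Ck_on_Suc_imp[OF s] half u u_eq])
  define s' where "s' l \<alpha> r = deriv_along l s \<alpha> r + T (kernel_deriv l N) u \<alpha> r" for l \<alpha> r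
  have s': "Ck_on k (ball p \<delta>) (s' l \<alpha>)" for l \<alpha>
  proof -
    have "Ck_on k (ball p \<delta>) (deriv_along l s \<alpha>)"
      using s[of \<alpha>] by (simp add: deriv_along_def[abs_def])
    then show ?thesis
      unfolding s'_def[abs_def]
      by (intro Ck_on_add open_ball Ck_on_T uk smooth_onD[OF smooth_on_kernel_deriv] N)
  qed
  have NS: "smooth_on (W \<alpha>) (kernel_scaled l N \<alpha> \<beta>)" for l \<alpha> \<beta>
    by (intro smooth_on_kernel_scaled N open_W)
  have halfS: "(\<Sum>\<beta>\<in>UNIV. \<bar>kernel_scaled l N \<alpha> \<beta> (r, t)\<bar>) \<le> 1 / 2"
    if "r \<in> ball p \<delta>" "t \<in> {0..1}" for l \<alpha> r t
    using half[OF that] that(2) by (rule row_sum_kernel_scaled)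
  have "\<exists>w. (\<forall>\<alpha>. continuous_on (ball p \<delta>) (w \<alpha>)) \<and>
      (\<forall>\<alpha>. \<forall>r\<in>ball p \<delta>. w \<alpha> r = s' l \<alpha> r + T (kernel_scaled l N) w \<alpha> r)" for l
    by (rule ex_fixed_point[of "kernel_scaled l N" "s' l", OF smooth_on_continuous_on[OF NS] Ck_on_continuous_on[OF s'] halfS]) blast+
  then obtain w where w: "\<And>l \<alpha>. continuous_on (ball p \<delta>) (w l \<alpha>)"
    "\<And>l \<alpha> r. r \<in> ball p \<delta> \<Longrightarrow> w l \<alpha> r = s' l \<alpha> r + T (kernel_scaled l N) (w l) \<alpha> r" by metis
  have wk: "Ck_on k (ball p \<delta>) (w l \<alpha>)" for l \<alpha>
    by (rule Suc.IH[of "kernel_scaled l N" "s' l" "w l", OF NS s' halfS w])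
  show ?case
  proof (rule Ck_on_SucI[where f' = "\<lambda>x v. \<Sum>l\<in>UNIV. v $ l * w l \<alpha> x", OF open_ball])
    show "(u \<alpha> has_derivative (\<lambda>v. \<Sum>l\<in>UNIV. v $ l * w l \<alpha> x)) (at x)" if "x \<in> ball p \<delta>" for x
      by (rule fixed_point_C1[of N s u w, OF smooth_onD[OF N] Ck_on_le[OF _ s] half u u_eq w(1) _ that])
        (use w(2) in \<open>simp_all add: s'_def\<close>)
    show "Ck_on k (ball p \<delta>) (\<lambda>x. \<Sum>l\<in>UNIV. v $ l * w l \<alpha> x)" for v
      by (intro Ck_on_sum Ck_on_mult Ck_on_const wk open_ball)
  qed
qed

end

section \<open>Darboux's theorem\<close>

text \<open>Used in place of \<open>partial_deriv\<close> because \<open>Ck_on\<close> is built on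
  \<open>frechet_derivative\<close>; both agree at points of differentiability.\<close>

abbreviation pd :: "'n::finite \<Rightarrow> (real^'n \<Rightarrow> real) \<Rightarrow> real^'n \<Rightarrow> real" where
  "pd j f r \<equiv> frechet_derivative f (at r) (axis j 1)"

lemma smooth_on_differentiable: "smooth_on S f \<Longrightarrow> x \<in> S \<Longrightarrow> f differentiable (at x)"
  using smooth_on_has_derivative differentiableI by blast

lemma pd_eqI: "(f has_derivative f') (at r) \<Longrightarrow> pd j f r = f' (axis j 1)"
  by (simp flip: frechet_derivative_at)

lemma pd_sum_mult:
  assumes "\<And>\<beta>. \<beta> \<in> I \<Longrightarrow> f \<beta> differentiable (at r)" "\<And>\<beta>. \<beta> \<in> I \<Longrightarrow> g \<beta> differentiable (at r)"
  shows "pd k (\<lambda>r. \<Sum>\<beta>\<in>I. f \<beta> r * g \<beta> r) r = (\<Sum>\<beta>\<in>I. f \<beta> r * pd k (g \<beta>) r + pd k (f \<beta>) r * g \<beta> r)"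
  by (rule pd_eqI) (auto intro!: has_derivative_sum has_derivative_mult frechet_derivative_works[THEN iffD1] assms)

context dilation_system
begin

text \<open>
  Poincare's homotopy formula for the form \<open>\<Sum>j\<in>D \<alpha>. \<omega> j dr\<^sub>j\<close>; the right-hand side integrates the
  curl of \<open>\<omega>\<close>.
\<close>

lemma pd_radial_primitive:
  fixes \<omega> :: "'n \<Rightarrow> real^'n \<Rightarrow> real"
  assumes \<omega>: "\<And>j. smooth_on (ball p \<delta>) (\<omega> j)" and k: "k \<in> D \<alpha>" and r: "r \<in> ball p \<delta>"
  shows "pd k (\<lambda>r. integral {0..1} (\<lambda>t. \<Sum>j\<in>D \<alpha>. (r $ j - p $ j) * \<omega> j (dilate (D \<alpha>) p (r, t)))) r - \<omega> k r =
    integral {0..1} (\<lambda>t. \<Sum>j\<in>D \<alpha>. (r $ j - p $ j) * (t * (pd k (\<omega> j) (dilate (D \<alpha>) p (r, t))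
      - pd j (\<omega> k) (dilate (D \<alpha>) p (r, t)))))"
proof -
  let ?d = "dilate (D \<alpha>) p"
  let ?d' = "\<lambda>z w. \<chi> j. if j \<in> D \<alpha> then snd w * (fst z $ j - p $ j) + snd z * (fst w $ j) else fst w $ j"
  define G where "G z = (\<Sum>j\<in>D \<alpha>. (fst z $ j - p $ j) * \<omega> j (?d z))" for z
  have comp: "smooth_on (W \<alpha>) (\<lambda>z. \<omega> j (?d z))" for j
    using smooth_on_compose[OF open_W \<omega> _ dilate_W] smooth_on_dilate smooth_on_subset by blast
  have lin: "smooth_on (W \<alpha>) (\<lambda>z. fst z $ j - p $ j)" for j
    by (intro smooth_on_diff open_W smooth_on_component smooth_on_const smooth_on_linear bounded_linear_fst)
  have G: "smooth_on (W \<alpha>) G"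
    unfolding G_def[abs_def] by (intro smooth_on_sum smooth_on_mult open_W comp lin)
  have inW: "(r, t) \<in> W \<alpha>" if "t \<in> {0..1}" for t using cylinder_subset_W r that by blast
  have inV: "?d (r, t) \<in> ball p \<delta>" if "t \<in> {0..1}" for t using dilate_mem_ball[OF r that] .
  have cont: "continuous_on {0..1} (\<lambda>t. f (?d (r, t)))" if "smooth_on (ball p \<delta>) f" for f :: "real^'n \<Rightarrow> real"
    using inV by (intro continuous_on_compose2[OF smooth_on_continuous_on[OF that]]
        continuous_on_compose2[OF continuous_on_dilate[of UNIV]] continuous_intros) auto
  have deriv: "((\<lambda>z. \<omega> j (?d z)) has_derivative (\<lambda>w. frechet_derivative (\<omega> j) (at (?d (r, t))) (?d' (r, t) w))) (at (r, t))"
    if "t \<in> {0..1}" for t j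
    by (rule has_derivative_compose[OF has_derivative_dilate smooth_on_has_derivative[OF \<omega> inV[OF that]]])
  have lin_\<omega>: "linear (frechet_derivative (\<omega> j) (at (?d (r, t))))" if "t \<in> {0..1}" for t j
    using has_derivative_linear[OF smooth_on_has_derivative[OF \<omega> inV[OF that]]] .
  have "pd k (\<lambda>r. integral {0..1} (\<lambda>t. G (r, t))) r = integral {0..1} (\<lambda>t. frechet_derivative G (at (r, t)) (axis k 1, 0))"
    by (rule pd_eqI, rule has_derivative_integral_unit[OF cylinder_subset_W open_ball r smooth_onD[OF G]])
  also have "\<dots> = integral {0..1} (\<lambda>t. \<omega> k (?d (r, t)) + (\<Sum>j\<in>D \<alpha>. (r $ j - p $ j) * (t * pd k (\<omega> j) (?d (r, t)))))"
  proof (rule integral_cong)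
    fix t :: real assume t: "t \<in> {0..1}"
    have "(G has_derivative (\<lambda>w. \<Sum>j\<in>D \<alpha>. (r $ j - p $ j) * frechet_derivative (\<omega> j) (at (?d (r, t))) (?d' (r, t) w)
        + (fst w $ j) * \<omega> j (?d (r, t)))) (at (r, t))"
      unfolding G_def[abs_def]
      by (rule has_derivative_sum, rule has_derivative_eq_rhs, rule has_derivative_mult[OF _ deriv[OF t]])
        (auto intro!: derivative_eq_intros bounded_linear.has_derivative[OF bounded_linear_vec_nth])
    from frechet_derivative_at[OF this, symmetric]
    have "frechet_derivative G (at (r, t)) (axis k 1, 0) =
        (\<Sum>j\<in>D \<alpha>. (r $ j - p $ j) * frechet_derivative (\<omega> j) (at (?d (r, t))) (?d' (r, t) (axis k 1, 0))
        + (axis k 1 :: real^'n) $ j * \<omega> j (?d (r, t)))" by simp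
    also have "?d' (r, t) (axis k 1, 0) = t *\<^sub>R axis k 1"
      using k by (auto simp: vec_eq_iff axis_def)
    also have "(\<Sum>j\<in>D \<alpha>. (r $ j - p $ j) * frechet_derivative (\<omega> j) (at (?d (r, t))) (t *\<^sub>R axis k 1)
        + (axis k 1 :: real^'n) $ j * \<omega> j (?d (r, t))) =
        \<omega> k (?d (r, t)) + (\<Sum>j\<in>D \<alpha>. (r $ j - p $ j) * (t * pd k (\<omega> j) (?d (r, t))))"
      using k by (simp add: sum.distrib linear_cmul[OF lin_\<omega>[OF t]] axis_def if_distrib[of "\<lambda>x. x * _"] cong: if_cong)
    finally show "frechet_derivative G (at (r, t)) (axis k 1, 0) =
        \<omega> k (?d (r, t)) + (\<Sum>j\<in>D \<alpha>. (r $ j - p $ j) * (t * pd k (\<omega> j) (?d (r, t))))" .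
  qed
  finally have primitive: "pd k (\<lambda>r. integral {0..1} (\<lambda>t. G (r, t))) r =
      integral {0..1} (\<lambda>t. \<omega> k (?d (r, t)) + (\<Sum>j\<in>D \<alpha>. (r $ j - p $ j) * (t * pd k (\<omega> j) (?d (r, t)))))" .
  \<comment> \<open>The integrand is the time derivative of
    \<open>t * \<omega> k (?d (r, t))\<close>, which is 0 at time 0 and \<open>\<omega> k r\<close>
    at time 1. This puts \<open>\<omega> k r\<close> under the same integral as the derivative of
    the primitive.\<close>
  have "((\<lambda>t. \<omega> k (?d (r, t)) + (\<Sum>j\<in>D \<alpha>. (r $ j - p $ j) * (t * pd j (\<omega> k) (?d (r, t)))))
      has_integral 1 * \<omega> k (?d (r, 1)) - 0 * \<omega> k (?d (r, 0))) {0..1}"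
  proof (rule fundamental_theorem_of_calculus)
    fix t :: real assume t: "t \<in> {0..1}"
    have "((\<lambda>t. (r, t)) has_derivative (\<lambda>s. (0, s))) (at t)"
      by (auto intro!: derivative_eq_intros)
    from has_derivative_compose[OF this deriv[OF t]]
    have "((\<lambda>t. \<omega> k (?d (r, t))) has_derivative
        (\<lambda>s. frechet_derivative (\<omega> k) (at (?d (r, t))) (?d' (r, t) (0, s)))) (at t)" .
    moreover have "frechet_derivative (\<omega> k) (at (?d (r, t))) (?d' (r, t) (0, s)) =
        s * (\<Sum>j\<in>D \<alpha>. (r $ j - p $ j) * pd j (\<omega> k) (?d (r, t)))" for s
    proof -
      have "?d' (r, t) (0, s) = s *\<^sub>R (\<Sum>j\<in>D \<alpha>. (r $ j - p $ j) *\<^sub>R axis j 1)"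
        by (auto simp: vec_eq_iff axis_def if_distrib[of "\<lambda>x. _ * x"] cong: if_cong)
      then show ?thesis by (simp add: linear_cmul[OF lin_\<omega>[OF t]] linear_sum[OF lin_\<omega>[OF t]])
    qed
    ultimately have "((\<lambda>t. \<omega> k (?d (r, t))) has_derivative
        (\<lambda>s. s * (\<Sum>j\<in>D \<alpha>. (r $ j - p $ j) * pd j (\<omega> k) (?d (r, t))))) (at t)" by simp
    from has_derivative_mult[OF has_derivative_ident this]
    have "((\<lambda>t. t * \<omega> k (?d (r, t))) has_vector_derivative
        \<omega> k (?d (r, t)) + (\<Sum>j\<in>D \<alpha>. (r $ j - p $ j) * (t * pd j (\<omega> k) (?d (r, t))))) (at t)"
      unfolding has_vector_derivative_def
      by (rule has_derivative_eq_rhs) (simp add: fun_eq_iff sum_distrib_left algebra_simps)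
    then show "((\<lambda>t. t * \<omega> k (?d (r, t))) has_vector_derivative
        \<omega> k (?d (r, t)) + (\<Sum>j\<in>D \<alpha>. (r $ j - p $ j) * (t * pd j (\<omega> k) (?d (r, t))))) (at t within {0..1})"
      by (rule has_vector_derivative_at_within)
  qed simp
  then have ftc: "\<omega> k r = integral {0..1} (\<lambda>t. \<omega> k (?d (r, t)) + (\<Sum>j\<in>D \<alpha>. (r $ j - p $ j) * (t * pd j (\<omega> k) (?d (r, t)))))"
    by (simp add: integral_unique)
  define A B where "A t = \<omega> k (?d (r, t)) + (\<Sum>j\<in>D \<alpha>. (r $ j - p $ j) * (t * pd k (\<omega> j) (?d (r, t))))"
    and "B t = \<omega> k (?d (r, t)) + (\<Sum>j\<in>D \<alpha>. (r $ j - p $ j) * (t * pd j (\<omega> k) (?d (r, t))))" for t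
  have int: "A integrable_on {0..1}" "B integrable_on {0..1}"
    unfolding A_def[abs_def] B_def[abs_def]
    by (intro integrable_continuous_real continuous_on_add continuous_on_sum continuous_on_mult
        continuous_on_const continuous_on_id cont[OF \<omega>] cont[OF smooth_on_frechet_derivative[OF \<omega>]])+
  have "pd k (\<lambda>r. integral {0..1} (\<lambda>t. G (r, t))) r - \<omega> k r = integral {0..1} A - integral {0..1} B"
    using primitive ftc by (simp add: A_def[abs_def] B_def[abs_def])
  also have "\<dots> = integral {0..1} (\<lambda>t. A t - B t)" by (rule integral_diff[OF int, symmetric])
  also have "(\<lambda>t. A t - B t) = (\<lambda>t. \<Sum>j\<in>D \<alpha>. (r $ j - p $ j) *
      (t * (pd k (\<omega> j) (?d (r, t)) - pd j (\<omega> k) (?d (r, t)))))"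
    by (simp add: A_def B_def sum_subtractf right_diff_distrib)
  finally show ?thesis by (simp add: G_def)
qed

end

text \<open>
  Darboux's theorem on linear systems that prescribe, for each unknown \<open>u \<alpha>\<close>, the partial
  derivatives in the directions \<open>D \<alpha>\<close> only. The terms \<open>M \<beta> k \<gamma>\<close> with \<open>k \<notin> D \<beta>\<close> that occur in the
  last assumption are multiplied by zero. With \<open>\<omega>\<close> the right-hand sides, the radial integral
  equation \<open>u \<alpha> = c \<alpha> + \<integral> \<Sum>j\<in>D \<alpha>. (r\<^sub>j - p\<^sub>j) \<omega> \<alpha> j\<close> is solved by contraction. By
  compatibility, the defects \<open>E \<alpha> k = \<partial>\<^sub>k u \<alpha> - \<omega> \<alpha> k\<close> of its solution satisfy a homogeneous
  equation with a contracting right-hand side, so they vanish.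
\<close>

theorem Darboux_linear_system:
  fixes M :: "'m::finite \<Rightarrow> 'n::finite \<Rightarrow> 'm \<Rightarrow> real^'n \<Rightarrow> real" and D :: "'m \<Rightarrow> 'n set"
  assumes U: "open U" "p \<in> U" and M: "\<And>\<alpha> j \<beta>. smooth_on U (M \<alpha> j \<beta>)"
    and closed: "\<And>\<alpha> j k \<beta> r. j \<in> D \<alpha> \<Longrightarrow> k \<in> D \<alpha> \<Longrightarrow> j \<noteq> k \<Longrightarrow> k \<notin> D \<beta> \<Longrightarrow> r \<in> U \<Longrightarrow> M \<alpha> j \<beta> r = 0"
    and compatible: "\<And>\<alpha> j k \<gamma> r. j \<in> D \<alpha> \<Longrightarrow> k \<in> D \<alpha> \<Longrightarrow> j \<noteq> k \<Longrightarrow> r \<in> U \<Longrightarrow>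
      pd k (M \<alpha> j \<gamma>) r + (\<Sum>\<beta>\<in>UNIV. M \<alpha> j \<beta> r * M \<beta> k \<gamma> r) =
      pd j (M \<alpha> k \<gamma>) r + (\<Sum>\<beta>\<in>UNIV. M \<alpha> k \<beta> r * M \<beta> j \<gamma> r)"
  shows "\<exists>\<delta>>0. ball p \<delta> \<subseteq> U \<and>
    (\<forall>c. \<exists>u. \<forall>\<alpha>. smooth_on (ball p \<delta>) (u \<alpha>) \<and> u \<alpha> p = c \<alpha> \<and>
      (\<forall>j\<in>D \<alpha>. \<forall>r\<in>ball p \<delta>. pd j (u \<alpha>) r = (\<Sum>\<beta>\<in>UNIV. M \<alpha> j \<beta> r * u \<beta> r)))"
proof -
  obtain \<delta>0 where \<delta>0: "\<delta>0 > 0" "cball p \<delta>0 \<subseteq> U" using U open_contains_cball by blast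
  have "continuous_on (cball p \<delta>0) (\<lambda>r. \<Sum>\<alpha>\<in>UNIV. \<Sum>j\<in>UNIV. \<Sum>\<beta>\<in>UNIV. \<bar>M \<alpha> j \<beta> r\<bar>)"
    by (intro continuous_on_sum continuous_on_rabs continuous_on_subset[OF smooth_on_continuous_on[OF M] \<delta>0(2)])
  then have "compact ((\<lambda>r. \<Sum>\<alpha>\<in>UNIV. \<Sum>j\<in>UNIV. \<Sum>\<beta>\<in>UNIV. \<bar>M \<alpha> j \<beta> r\<bar>) ` cball p \<delta>0)"
    by (rule compact_continuous_image) (rule compact_cball)
  then obtain K0 where K0: "\<forall>y\<in>(\<lambda>r. \<Sum>\<alpha>\<in>UNIV. \<Sum>j\<in>UNIV. \<Sum>\<beta>\<in>UNIV. \<bar>M \<alpha> j \<beta> r\<bar>) ` cball p \<delta>0. norm y \<le> K0"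
    using compact_imp_bounded bounded_iff by metis
  define K where "K = \<bar>K0\<bar> + 1"
  have K_pos: "K > 0" by (simp add: K_def)
  have K: "\<bar>M \<alpha> j \<beta> r\<bar> \<le> K" if "r \<in> cball p \<delta>0" for \<alpha> j \<beta> r
  proof -
    have "\<bar>M \<alpha> j \<beta> r\<bar> \<le> (\<Sum>\<beta>\<in>UNIV. \<bar>M \<alpha> j \<beta> r\<bar>)" by (rule member_le_sum) auto
    also have "\<dots> \<le> (\<Sum>j\<in>UNIV. \<Sum>\<beta>\<in>UNIV. \<bar>M \<alpha> j \<beta> r\<bar>)" by (rule member_le_sum) (auto intro: sum_nonneg)
    also have "\<dots> \<le> (\<Sum>\<alpha>\<in>UNIV. \<Sum>j\<in>UNIV. \<Sum>\<beta>\<in>UNIV. \<bar>M \<alpha> j \<beta> r\<bar>)"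
      by (rule member_le_sum) (auto intro!: sum_nonneg)
    also have "\<dots> \<le> K" using bspec[OF K0 imageI[OF that]] by (simp add: K_def)
    finally show ?thesis .
  qed
  define m n where "m = real CARD('m)" and "n = real CARD('n)"
  have mn: "m > 0" "n > 0" by (simp_all add: m_def n_def)
  \<comment> \<open>Kernel row sums have at most \<open>m * n\<close> terms, each at most
    \<open>\<delta> * K\<close>. The bound 1/4 instead of 1/2 leaves room for the defects: the curl
    has two terms per unknown, which doubles the constant.\<close>
  define \<delta> where "\<delta> = min \<delta>0 (1 / (4 * m * n * K))"
  have \<delta>: "\<delta> > 0" "\<delta> \<le> \<delta>0" using \<delta>0 mn K_pos by (auto simp: \<delta>_def)
  have small: "\<delta> * (m * n * K) \<le> 1 / 4"
  proof -
    have "\<delta> * (m * n * K) \<le> 1 / (4 * m * n * K) * (m * n * K)"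
      using mn K_pos by (intro mult_right_mono) (auto simp: \<delta>_def)
    then show ?thesis using mn K_pos by simp
  qed
  have V: "ball p \<delta> \<subseteq> cball p \<delta>0" "ball p \<delta> \<subseteq> U" using \<delta> \<delta>0 by (auto simp: subset_iff)
  have MV: "smooth_on (ball p \<delta>) (M \<alpha> j \<beta>)" for \<alpha> j \<beta> using smooth_on_subset[OF M V(2)] .
  have KV: "\<bar>M \<alpha> j \<beta> r\<bar> \<le> K" if "r \<in> ball p \<delta>" for \<alpha> j \<beta> r using K V that by blast
  have coord: "\<bar>r $ j - p $ j\<bar> \<le> \<delta>" if "r \<in> ball p \<delta>" for r j
    using component_le_norm_cart[of "r - p" j] that by (simp add: dist_norm norm_minus_commute)
  interpret dilation_system p \<delta> D .
  define N where "N \<alpha> \<beta> z = (\<Sum>j\<in>D \<alpha>. (fst z $ j - p $ j) * M \<alpha> j \<beta> (dilate (D \<alpha>) p z))" for \<alpha> \<beta> z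
  have N: "smooth_on (W \<alpha>) (N \<alpha> \<beta>)" for \<alpha> \<beta>
  proof -
    have "smooth_on (W \<alpha>) (\<lambda>z. M \<alpha> j \<beta> (dilate (D \<alpha>) p z))" for j
      using smooth_on_compose[OF open_W MV _ dilate_W] smooth_on_dilate smooth_on_subset by blast
    moreover have "smooth_on (W \<alpha>) (\<lambda>z. fst z $ j - p $ j)" for j
      by (intro smooth_on_diff open_W smooth_on_component smooth_on_const smooth_on_linear bounded_linear_fst)
    ultimately show ?thesis unfolding N_def[abs_def] by (intro smooth_on_sum smooth_on_mult open_W)
  qed
  have half: "(\<Sum>\<beta>\<in>UNIV. \<bar>N \<alpha> \<beta> (r, t)\<bar>) \<le> 1 / 2" if "r \<in> ball p \<delta>" "t \<in> {0..1}" for \<alpha> r t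
  proof -
    have "\<bar>N \<alpha> \<beta> (r, t)\<bar> \<le> n * (\<delta> * K)" for \<beta>
    proof -
      have "\<bar>N \<alpha> \<beta> (r, t)\<bar> \<le> (\<Sum>j\<in>D \<alpha>. \<delta> * K)"
        unfolding N_def fst_conv
        by (rule order_trans[OF sum_abs], rule sum_mono)
          (use \<delta> in \<open>auto simp: abs_mult simp del: mem_ball intro!: mult_mono coord KV dilate_mem_ball that\<close>)
      also have "\<dots> \<le> (\<Sum>j\<in>(UNIV::'n set). \<delta> * K)" using \<delta> K_pos by (intro sum_mono2) auto
      finally show ?thesis by (simp add: n_def)
    qed
    then have "(\<Sum>\<beta>\<in>UNIV. \<bar>N \<alpha> \<beta> (r, t)\<bar>) \<le> (\<Sum>\<beta>\<in>(UNIV::'m set). n * (\<delta> * K))" by (intro sum_mono)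
    also have "\<dots> = \<delta> * (m * n * K)" by (simp add: m_def)
    finally show ?thesis using small by simp
  qed
  have "\<exists>u. \<forall>\<alpha>. smooth_on (ball p \<delta>) (u \<alpha>) \<and> u \<alpha> p = c \<alpha> \<and>
      (\<forall>j\<in>D \<alpha>. \<forall>r\<in>ball p \<delta>. pd j (u \<alpha>) r = (\<Sum>\<beta>\<in>UNIV. M \<alpha> j \<beta> r * u \<beta> r))" for c
  proof -
    have c: "Ck_on k (ball p \<delta>) (\<lambda>_. c \<alpha>)" for k \<alpha> by (rule Ck_on_const)
    obtain u where u_cont: "\<And>\<alpha>. continuous_on (ball p \<delta>) (u \<alpha>)"
      and u_eq: "\<And>\<alpha> r. r \<in> ball p \<delta> \<Longrightarrow> u \<alpha> r = c \<alpha> + T N u \<alpha> r"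
      by (rule ex_fixed_point[of N "\<lambda>\<alpha> _. c \<alpha>", OF smooth_on_continuous_on[OF N] Ck_on_continuous_on[OF c] half]) blast+
    have u: "smooth_on (ball p \<delta>) (u \<alpha>)" for \<alpha>
      by (rule smooth_onI) (rule fixed_point_Ck[of N _ "\<lambda>\<alpha> _. c \<alpha>" u, OF N c half u_cont u_eq])
    define \<omega> where "\<omega> \<alpha> j r = (\<Sum>\<beta>\<in>UNIV. M \<alpha> j \<beta> r * u \<beta> r)" for \<alpha> j r
    have \<omega>: "smooth_on (ball p \<delta>) (\<omega> \<alpha> j)" for \<alpha> j
      unfolding \<omega>_def[abs_def] by (intro smooth_on_sum smooth_on_mult open_ball MV u)
    define E where "E \<alpha> k r = pd k (u \<alpha>) r - \<omega> \<alpha> k r" for \<alpha> k r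
    have E_cont: "continuous_on (ball p \<delta>) (E \<alpha> k)" for \<alpha> k
      unfolding E_def[abs_def]
      by (intro smooth_on_continuous_on smooth_on_diff open_ball smooth_on_frechet_derivative u \<omega>)
    have TN: "T N u \<alpha> r = integral {0..1} (\<lambda>t. \<Sum>j\<in>D \<alpha>. (r $ j - p $ j) * \<omega> \<alpha> j (dilate (D \<alpha>) p (r, t)))" for \<alpha> r
    proof -
      have "integrand N u \<alpha> (r, t) = (\<Sum>j\<in>D \<alpha>. (r $ j - p $ j) * \<omega> \<alpha> j (dilate (D \<alpha>) p (r, t)))" for t
        unfolding integrand_def N_def \<omega>_def fst_conv sum_distrib_left sum_distrib_right
        by (subst sum.swap) (simp add: mult.assoc)
      then show ?thesis by (simp add: T_def)
    qed
    have E_eq: "E \<alpha> k r = integral {0..1} (\<lambda>t. \<Sum>j\<in>D \<alpha>. (r $ j - p $ j) *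
        (t * (pd k (\<omega> \<alpha> j) (dilate (D \<alpha>) p (r, t)) - pd j (\<omega> \<alpha> k) (dilate (D \<alpha>) p (r, t)))))"
      if k: "k \<in> D \<alpha>" and r: "r \<in> ball p \<delta>" for \<alpha> k r
    proof -
      have "smooth_on (ball p \<delta>) (\<lambda>r. T N u \<alpha> r)"
        by (rule smooth_onI) (intro Ck_on_T smooth_onD N u)
      from smooth_on_has_derivative[OF this r]
      have "((\<lambda>r. c \<alpha> + T N u \<alpha> r) has_derivative frechet_derivative (\<lambda>r. T N u \<alpha> r) (at r)) (at r)"
        by (auto intro: derivative_eq_intros)
      then have "(u \<alpha> has_derivative frechet_derivative (\<lambda>r. T N u \<alpha> r) (at r)) (at r)"
        by (rule has_derivative_transform_within_open[OF _ open_ball r]) (simp add: u_eq)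
      then have "pd k (u \<alpha>) r = pd k (\<lambda>r. T N u \<alpha> r) r" by (rule pd_eqI)
      then show ?thesis
        unfolding E_def TN using pd_radial_primitive[of "\<omega> \<alpha>", OF \<omega> k r] by simp
    qed
    \<comment> \<open>Write \<open>pd k (u \<beta>)\<close> as
      \<open>\<omega> \<beta> k + E \<beta> k\<close>. All terms without a defect cancel by
      \<open>compatible\<close>, so the curl is linear and homogeneous in the defects.\<close>
    have curl: "pd k (\<omega> \<alpha> j) q - pd j (\<omega> \<alpha> k) q = (\<Sum>\<beta>\<in>UNIV. M \<alpha> j \<beta> q * E \<beta> k q - M \<alpha> k \<beta> q * E \<beta> j q)"
      if j: "j \<in> D \<alpha>" and k: "k \<in> D \<alpha>" and jk: "j \<noteq> k" and q: "q \<in> ball p \<delta>" for \<alpha> j k q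
    proof -
      have pd_\<omega>: "pd k (\<omega> \<alpha> j) q = (\<Sum>\<beta>\<in>UNIV. M \<alpha> j \<beta> q * E \<beta> k q) +
          (\<Sum>\<gamma>\<in>UNIV. (pd k (M \<alpha> j \<gamma>) q + (\<Sum>\<beta>\<in>UNIV. M \<alpha> j \<beta> q * M \<beta> k \<gamma> q)) * u \<gamma> q)" for j k
      proof -
        have "pd k (\<omega> \<alpha> j) q = (\<Sum>\<beta>\<in>UNIV. M \<alpha> j \<beta> q * pd k (u \<beta>) q + pd k (M \<alpha> j \<beta>) q * u \<beta> q)"
          unfolding \<omega>_def[abs_def]
          by (rule pd_sum_mult) (rule smooth_on_differentiable[OF MV q] smooth_on_differentiable[OF u q])+
        also have "\<dots> = (\<Sum>\<beta>\<in>UNIV. M \<alpha> j \<beta> q * E \<beta> k q) + (\<Sum>\<beta>\<in>UNIV. M \<alpha> j \<beta> q * \<omega> \<beta> k q)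
            + (\<Sum>\<gamma>\<in>UNIV. pd k (M \<alpha> j \<gamma>) q * u \<gamma> q)"
          by (simp add: E_def sum.distrib sum_subtractf right_diff_distrib)
        also have "(\<Sum>\<beta>\<in>UNIV. M \<alpha> j \<beta> q * \<omega> \<beta> k q) = (\<Sum>\<gamma>\<in>UNIV. (\<Sum>\<beta>\<in>UNIV. M \<alpha> j \<beta> q * M \<beta> k \<gamma> q) * u \<gamma> q)"
          unfolding \<omega>_def sum_distrib_left sum_distrib_right by (subst sum.swap) (simp add: mult.assoc)
        finally show ?thesis by (simp add: distrib_right sum.distrib)
      qed
      have "q \<in> U" using q V by blast
      then show ?thesis
        unfolding pd_\<omega> compatible[OF j k jk \<open>q \<in> U\<close>] by (simp add: sum_subtractf)
    qed
    have E0: "E \<alpha> k r = 0" if k: "k \<in> D \<alpha>" and r: "r \<in> ball p \<delta>" for \<alpha> k r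
    proof -
      define \<rho> where "\<rho> = dist p r"
      have \<rho>: "\<rho> < \<delta>" "r \<in> cball p \<rho>" using r by (auto simp: \<rho>_def)
      have sub: "x \<in> ball p \<delta>" if "x \<in> cball p \<rho>" for x using that \<rho> by auto
      obtain e where e: "e \<ge> 0" "\<And>\<alpha> k x. x \<in> cball p \<rho> \<Longrightarrow> \<bar>E \<alpha> k x\<bar> \<le> e"
        using bounded_on_cball[of "\<lambda>(\<alpha>, k). E \<alpha> k" \<rho>] E_cont \<rho>(1) by auto
      have "\<bar>E \<alpha> k x\<bar> \<le> e * (1/2)^i" if "k \<in> D \<alpha>" "x \<in> cball p \<rho>" for i \<alpha> k x
        using that
      proof (induction i arbitrary: \<alpha> k x)
        case 0
        then show ?case using e by simp
      next
        case (Suc i)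
        let ?d = "\<lambda>t. dilate (D \<alpha>) p (x, t)"
        let ?e = "e * (1/2)^i"
        have e_nonneg: "?e \<ge> 0" using e(1) by simp
        have bound: "\<bar>pd k (\<omega> \<alpha> j) q - pd j (\<omega> \<alpha> k) q\<bar> \<le> m * (2 * K * ?e)"
          if j: "j \<in> D \<alpha>" and q: "q \<in> cball p \<rho>" for j q
        proof (cases "j = k")
          case True
          then show ?thesis using mn K_pos e_nonneg by simp
        next
          case False
          \<comment> \<open>If \<open>b \<notin> D \<beta>\<close>, no equation prescribes that
            derivative and \<open>E \<beta> b\<close> need not be small; but then
            \<open>closed\<close> makes its coefficient vanish.\<close>
          have ME: "\<bar>M \<alpha> a \<beta> q * E \<beta> b q\<bar> \<le> K * ?e" if "a \<in> D \<alpha>" "b \<in> D \<alpha>" "a \<noteq> b" for a b \<beta>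
          proof (cases "b \<in> D \<beta>")
            case True
            then show ?thesis
              unfolding abs_mult using K_pos by (intro mult_mono KV sub q Suc.IH) auto
          next
            case False
            then have "M \<alpha> a \<beta> q = 0" using closed that sub[OF q] V by blast
            then show ?thesis using K_pos e_nonneg by simp
          qed
          have "\<bar>pd k (\<omega> \<alpha> j) q - pd j (\<omega> \<alpha> k) q\<bar> \<le>
              (\<Sum>\<beta>\<in>UNIV. \<bar>M \<alpha> j \<beta> q * E \<beta> k q - M \<alpha> k \<beta> q * E \<beta> j q\<bar>)"
            unfolding curl[OF j Suc.prems(1) False sub[OF q]] by (rule sum_abs)
          also have "\<dots> \<le> (\<Sum>\<beta>\<in>(UNIV::'m set). K * ?e + K * ?e)"
            using ME[OF j Suc.prems(1) False] ME[OF Suc.prems(1) j not_sym[OF False]]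
            by (intro sum_mono order_trans[OF abs_triangle_ineq4] add_mono)
          finally show ?thesis by (simp add: m_def algebra_simps)
        qed
        have "norm (integral {0..1} (\<lambda>t. \<Sum>j\<in>D \<alpha>. (x $ j - p $ j) * (t * (pd k (\<omega> \<alpha> j) (?d t) - pd j (\<omega> \<alpha> k) (?d t)))))
            \<le> (n * (\<delta> * (m * (2 * K * ?e)))) * (1 - 0)"
        proof (rule integral_bound)
          have cont: "continuous_on {0..1} (\<lambda>t. f (?d t))" if "smooth_on (ball p \<delta>) f" for f :: "real^'n \<Rightarrow> real"
            using dilate_mem_ball[OF sub[OF Suc.prems(2)]]
            by (intro continuous_on_compose2[OF smooth_on_continuous_on[OF that]]
                continuous_on_compose2[OF continuous_on_dilate[of UNIV]] continuous_intros) auto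
          show "continuous_on {0..1} (\<lambda>t. \<Sum>j\<in>D \<alpha>. (x $ j - p $ j) * (t * (pd k (\<omega> \<alpha> j) (?d t) - pd j (\<omega> \<alpha> k) (?d t))))"
            by (intro continuous_on_sum continuous_on_mult continuous_on_diff continuous_on_const continuous_on_id
                cont[OF smooth_on_frechet_derivative[OF \<omega>]])
          fix t :: real assume t: "t \<in> {0..1}"
          have "\<bar>(x $ j - p $ j) * (t * (pd k (\<omega> \<alpha> j) (?d t) - pd j (\<omega> \<alpha> k) (?d t)))\<bar> \<le> \<delta> * (1 * (m * (2 * K * ?e)))"
            if "j \<in> D \<alpha>" for j
            unfolding abs_mult using t \<delta>(1)
            by (intro mult_mono coord sub Suc.prems bound that dilate_mem_cball) auto
          then have "norm (\<Sum>j\<in>D \<alpha>. (x $ j - p $ j) * (t * (pd k (\<omega> \<alpha> j) (?d t) - pd j (\<omega> \<alpha> k) (?d t))))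
              \<le> (\<Sum>j\<in>D \<alpha>. \<delta> * (1 * (m * (2 * K * ?e))))"
            unfolding real_norm_def by (intro order_trans[OF sum_abs] sum_mono)
          also have "\<dots> \<le> (\<Sum>j\<in>(UNIV::'n set). \<delta> * (1 * (m * (2 * K * ?e))))"
            using \<delta>(1) mn K_pos e_nonneg by (intro sum_mono2) auto
          finally show "norm (\<Sum>j\<in>D \<alpha>. (x $ j - p $ j) * (t * (pd k (\<omega> \<alpha> j) (?d t) - pd j (\<omega> \<alpha> k) (?d t))))
              \<le> n * (\<delta> * (m * (2 * K * ?e)))" by (simp add: n_def)
        qed simp
        then have "\<bar>E \<alpha> k x\<bar> \<le> (\<delta> * (m * n * K)) * (2 * ?e)"
          unfolding E_eq[OF Suc.prems(1) sub[OF Suc.prems(2)]] by (simp add: mult_ac)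
        also have "\<dots> \<le> 1 / 4 * (2 * ?e)" using small e_nonneg by (intro mult_right_mono) auto
        finally show ?case by simp
      qed
      then have "\<bar>E \<alpha> k r\<bar> \<le> e * (1/2)^i" for i using k \<rho> by blast
      moreover have "(\<lambda>i. e * (1/2)^i) \<longlonglongrightarrow> 0" by (intro tendsto_mult_right_zero LIMSEQ_realpow_zero) auto
      ultimately have "\<bar>E \<alpha> k r\<bar> \<le> 0" by (intro LIMSEQ_le_const) auto
      then show ?thesis by simp
    qed
    \<comment> \<open>At \<open>p\<close> all factors \<open>r $ j - p $ j\<close> in the integral
      vanish.\<close>
    have "u \<alpha> p = c \<alpha>" for \<alpha>
      using u_eq[of p \<alpha>] \<delta>(1) by (simp add: TN)
    then show ?thesis using u E0 by (intro exI[of _ u]) (auto simp: E_def \<omega>_def)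
  qed
  then show ?thesis using \<delta>(1) V(2) by blast
qed

section \<open>Diagonal systems\<close>

lemma partial_deriv_eq_pd:
  assumes "f differentiable (at r)"
  shows "partial_deriv k f r = pd k f r"
proof -
  have d: "(f has_derivative frechet_derivative f (at r)) (at r)"
    using assms frechet_derivative_works by blast
  have "((\<lambda>t. r + t *\<^sub>R axis k 1) has_derivative (\<lambda>t. t *\<^sub>R axis k 1)) (at 0)"
    by (auto intro!: derivative_eq_intros)
  from has_derivative_compose[OF this, of f "frechet_derivative f (at r)"] d
  have "((\<lambda>t. f (r + t *\<^sub>R axis k 1)) has_derivative (\<lambda>t. frechet_derivative f (at r) (t *\<^sub>R axis k 1))) (at 0)"
    by simp
  then have "((\<lambda>t. f (r + t *\<^sub>R axis k 1)) has_real_derivative pd k f r) (at 0)"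
    unfolding has_field_derivative_def
    by (rule has_derivative_eq_rhs) (simp add: linear_cmul[OF has_derivative_linear[OF d]] fun_eq_iff mult.commute)
  then show ?thesis unfolding partial_deriv_def by (rule DERIV_imp_deriv)
qed

lemma pd_mult:
  assumes "f differentiable (at r)" "g differentiable (at r)"
  shows "pd k (\<lambda>s. f s * g s) r = f r * pd k g r + pd k f r * g r"
  using pd_sum_mult[of "{()}" "\<lambda>_. f" r "\<lambda>_. g" k] assms by simp

lemma pd_add:
  assumes "f differentiable (at r)" "g differentiable (at r)"
  shows "pd k (\<lambda>s. f s + g s) r = pd k f r + pd k g r"
  by (rule pd_eqI) (intro has_derivative_add frechet_derivative_works[THEN iffD1] assms)

lemma pd_diff:
  assumes "f differentiable (at r)" "g differentiable (at r)"
  shows "pd k (\<lambda>s. f s - g s) r = pd k f r - pd k g r"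
  by (rule pd_eqI) (intro has_derivative_diff frechet_derivative_works[THEN iffD1] assms)

lemma pd_chain:
  assumes "f differentiable (at r)" "(h has_real_derivative d) (at (f r))"
  shows "pd k (\<lambda>s. h (f s)) r = pd k f r * d"
  by (rule pd_eqI, rule DERIV_compose_FDERIV[OF assms(2) frechet_derivative_works[THEN iffD1, OF assms(1)]])

lemma pd_const: "pd k (\<lambda>_. c) r = 0"
  by (simp add: frechet_derivative_const)

lemma pd_cong:
  assumes "open V" "r \<in> V" "\<And>s. s \<in> V \<Longrightarrow> f s = g s" "g differentiable (at r)"
  shows "pd k f r = pd k g r"
  using assms
  by (intro pd_eqI has_derivative_transform_within_open[OF frechet_derivative_works[THEN iffD1, OF assms(4)]]) auto

lemma pd_commute:
  assumes "open S" "smooth_on S f" "r \<in> S"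
  shows "pd k (\<lambda>s. pd j f s) r = pd j (\<lambda>s. pd k f s) r"
  by (rule frechet_derivative_commute[OF assms(1) smooth_onD[OF assms(2)] assms(3)])

text \<open>
  The condition \<open>\<partial>\<^sub>k a\<^sub>j\<^sub>i = \<partial>\<^sub>i a\<^sub>j\<^sub>k\<close> expresses \<open>S = \<partial>\<^sub>i\<partial>\<^sub>k\<phi>\<^sub>j\<close> through the first derivatives
  \<open>P = \<partial>\<^sub>i\<phi>\<^sub>j\<close>, \<open>Q = \<partial>\<^sub>k\<phi>\<^sub>j\<close>, \<open>X = \<partial>\<^sub>k\<phi>\<^sub>i\<close>, \<open>Y = \<partial>\<^sub>i\<phi>\<^sub>k\<close> and the angles \<open>\<alpha> = \<phi>\<^sub>i - \<phi>\<^sub>j\<close>, \<open>\<beta> = \<phi>\<^sub>k - \<phi>\<^sub>j\<close>.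
\<close>

lemma trig_compatibility:
  fixes S P Q X Y \<alpha> \<beta> :: real
  assumes nz: "sin \<alpha> \<noteq> 0" "sin \<beta> \<noteq> 0" "sin (\<beta> - \<alpha>) \<noteq> 0"
    and hyp: "P * ((X - Q) * - inverse ((sin \<alpha>)\<^sup>2)) + S * cot \<alpha> = Q * ((Y - P) * - inverse ((sin \<beta>)\<^sup>2)) + S * cot \<beta>"
  shows "P * ((X - Q) * - (cos \<alpha> / (sin \<alpha>)\<^sup>2)) + S * inverse (sin \<alpha>) + P * inverse (sin \<alpha>) * (Q * cot \<beta>) =
    X * cot (\<beta> - \<alpha>) * (P * inverse (sin \<alpha>)) + Y * inverse (sin (\<alpha> - \<beta>)) * (Q * inverse (sin \<beta>))"
    (is "?L = ?R")
proof -
  define sa ca sb cb where defs: "sa = sin \<alpha>" "ca = cos \<alpha>" "sb = sin \<beta>" "cb = cos \<beta>"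
  define d where "d = ca * sb - cb * sa"
  have d: "sin (\<beta> - \<alpha>) = d" "sin (\<alpha> - \<beta>) = - d" "cos (\<beta> - \<alpha>) = ca * cb + sa * sb"
    by (simp_all add: d_def defs sin_diff cos_diff algebra_simps)
  have nz': "sa \<noteq> 0" "sb \<noteq> 0" "d \<noteq> 0" using nz d by (simp_all add: defs)
  have p1: "ca\<^sup>2 = 1 - sa\<^sup>2" "cb\<^sup>2 = 1 - sb\<^sup>2" by (simp_all add: defs cos_squared_eq)
  have "P * ((X - Q) * - inverse (sa\<^sup>2)) + S * (ca / sa) = Q * ((Y - P) * - inverse (sb\<^sup>2)) + S * (cb / sb)"
    using hyp by (simp add: defs cot_def)
  then have eq: "(P * ((X - Q) * - inverse (sa\<^sup>2)) + S * (ca / sa)) * (sa\<^sup>2 * sb\<^sup>2) =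
      (Q * ((Y - P) * - inverse (sb\<^sup>2)) + S * (cb / sb)) * (sa\<^sup>2 * sb\<^sup>2)" by simp
  have lhs: "(P * ((X - Q) * - inverse (sa\<^sup>2)) + S * (ca / sa)) * (sa\<^sup>2 * sb\<^sup>2) =
      S * sa * sb * (ca * sb) - P * (X - Q) * sb\<^sup>2"
    using nz' by (simp add: field_simps power2_eq_square)
  have rhs: "(Q * ((Y - P) * - inverse (sb\<^sup>2)) + S * (cb / sb)) * (sa\<^sup>2 * sb\<^sup>2) =
      S * sa * sb * (cb * sa) - Q * (Y - P) * sa\<^sup>2"
    using nz' by (simp add: field_simps power2_eq_square)
  \<comment> \<open>Since \<open>cot \<alpha> - cot \<beta> = d / (sa * sb)\<close> and
    \<open>d \<noteq> 0\<close>, the hypothesis determines \<open>S\<close>. Inserting it into the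
    claim, multiplied by \<open>sa\<^sup>2 * sb * d\<close>, leaves a polynomial identity modulo
    \<open>p1\<close>.\<close>
  have S: "S * sa * sb * d = P * (X - Q) * sb\<^sup>2 - Q * (Y - P) * sa\<^sup>2"
    using eq unfolding lhs rhs by (simp add: d_def algebra_simps)
  have "S * sa * sb * d - P * ca * (X - Q) * sb * d + P * Q * sa * cb * d =
      X * (ca * cb + sa * sb) * P * sa * sb - Y * Q * sa\<^sup>2"
    unfolding S unfolding d_def using p1 by algebra
  moreover have "?L * (sa\<^sup>2 * sb * d) = S * sa * sb * d - P * ca * (X - Q) * sb * d + P * Q * sa * cb * d"
    unfolding cot_def defs[symmetric] using nz' by (simp add: field_simps power2_eq_square)
  moreover have "?R * (sa\<^sup>2 * sb * d) = X * (ca * cb + sa * sb) * P * sa * sb - Y * Q * sa\<^sup>2"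
    unfolding cot_def d defs[symmetric] using nz' by (simp add: field_simps power2_eq_square)
  ultimately have "?L * (sa\<^sup>2 * sb * d) = ?R * (sa\<^sup>2 * sb * d)" by simp
  then show ?thesis using nz' by simp
qed

section \<open>Coefficients and compatibility of the system for the rows\<close>

locale diagonal_system =
  fixes \<phi> :: "'n::finite \<Rightarrow> real^'n \<Rightarrow> real" and U :: "(real^'n) set"
  assumes open_U: "open U" and smooth: "\<And>i. smooth_on U (\<phi> i)"
    and sin_nonzero: "\<And>i j r. r \<in> U \<Longrightarrow> i \<noteq> j \<Longrightarrow> sin (\<phi> i r - \<phi> j r) \<noteq> 0"
begin

text \<open>
  The row \<open>\<mu>\<close> of \<open>C\<close> that belongs to a conservation law solves
  \<open>\<partial>\<^sub>j \<mu>\<^sub>i = self_coeff i j \<mu>\<^sub>i + cross_coeff i j \<mu>\<^sub>j\<close> for \<open>j \<noteq> i\<close>. For \<open>i = j\<close> both coefficients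
  vanish, since \<open>cot 0 = inverse 0 = 0\<close>.
\<close>

definition self_coeff :: "'n \<Rightarrow> 'n \<Rightarrow> real^'n \<Rightarrow> real" where
  "self_coeff i j = (\<lambda>r. pd j (\<phi> i) r * cot (\<phi> j r - \<phi> i r))"

definition cross_coeff :: "'n \<Rightarrow> 'n \<Rightarrow> real^'n \<Rightarrow> real" where
  "cross_coeff i j = (\<lambda>r. pd i (\<phi> j) r * inverse (sin (\<phi> i r - \<phi> j r)))"

lemma smooth_self_coeff: "smooth_on U (self_coeff i j)"
proof (cases "i = j")
  case True
  then show ?thesis by (simp add: self_coeff_def smooth_on_const)
next
  case False
  then show ?thesis
    unfolding self_coeff_def
    by (intro smooth_on_mult smooth_on_cot smooth_on_diff smooth_on_frechet_derivative open_U smooth sin_nonzero) auto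
qed

lemma smooth_cross_coeff: "smooth_on U (cross_coeff i j)"
proof (cases "i = j")
  case True
  then show ?thesis by (simp add: cross_coeff_def smooth_on_const)
next
  case False
  then show ?thesis
    unfolding cross_coeff_def
    by (intro smooth_on_mult smooth_on_inverse smooth_on_sin smooth_on_diff smooth_on_frechet_derivative
        open_U smooth sin_nonzero)
qed

lemmas differentiable = smooth_on_differentiable[OF smooth]
  smooth_on_differentiable[OF smooth_self_coeff] smooth_on_differentiable[OF smooth_cross_coeff]
  smooth_on_differentiable[OF smooth_on_frechet_derivative[OF smooth]]

lemma differentiable_phase_diff: "r \<in> U \<Longrightarrow> (\<lambda>r. \<phi> i r - \<phi> j r) differentiable (at r)"
  by (intro differentiable_diff differentiable)

lemma pd_self_coeff:
  assumes "i \<noteq> j" "r \<in> U"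
  shows "pd k (self_coeff i j) r =
    pd j (\<phi> i) r * ((pd k (\<phi> j) r - pd k (\<phi> i) r) * - inverse ((sin (\<phi> j r - \<phi> i r))\<^sup>2))
    + pd k (\<lambda>r. pd j (\<phi> i) r) r * cot (\<phi> j r - \<phi> i r)"
proof -
  note cot = pd_chain[OF differentiable_phase_diff DERIV_cot[OF sin_nonzero], OF assms(2) assms(2) not_sym[OF assms(1)]]
  have "(\<lambda>r. cot (\<phi> j r - \<phi> i r)) differentiable (at r)"
    using assms by (intro smooth_on_differentiable[of U] smooth_on_cot smooth_on_diff open_U smooth sin_nonzero) auto
  then show ?thesis
    unfolding self_coeff_def using assms(2)
    by (subst pd_mult) (simp_all add: differentiable cot pd_diff)
qed

lemma pd_cross_coeff:
  assumes "i \<noteq> j" "r \<in> U"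
  shows "pd k (cross_coeff i j) r =
    pd i (\<phi> j) r * ((pd k (\<phi> i) r - pd k (\<phi> j) r) * - (cos (\<phi> i r - \<phi> j r) / (sin (\<phi> i r - \<phi> j r))\<^sup>2))
    + pd k (\<lambda>r. pd i (\<phi> j) r) r * inverse (sin (\<phi> i r - \<phi> j r))"
proof -
  have "((\<lambda>x. inverse (sin x)) has_real_derivative - (cos x / (sin x)\<^sup>2)) (at x)" if "sin x \<noteq> 0" for x :: real
    using that by (auto intro!: derivative_eq_intros simp: power2_eq_square field_simps)
  note inv = pd_chain[OF differentiable_phase_diff this[OF sin_nonzero], OF assms(2) assms(2) assms(1)]
  have "(\<lambda>r. inverse (sin (\<phi> i r - \<phi> j r))) differentiable (at r)"
    using assms by (intro smooth_on_differentiable[of U] smooth_on_inverse smooth_on_sin smooth_on_diff open_U smooth sin_nonzero) auto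
  then show ?thesis
    unfolding cross_coeff_def using assms(2)
    by (subst pd_mult) (simp_all add: differentiable inv pd_diff)
qed

text \<open>Both sides are the coefficients of \<open>\<mu>\<^sub>j\<close> in the mixed derivative
  of \<open>\<mu>\<^sub>i\<close> along \<open>j\<close> and \<open>k\<close>, computed in the two
  orders. The only second derivative involved is that of \<open>\<phi> j\<close> along
  \<open>i\<close> and \<open>k\<close>, which is why the condition enters with \<open>j\<close> as
  its base index.\<close>

lemma cross_compatible:
  assumes ne: "i \<noteq> j" "k \<noteq> j" "i \<noteq> k" and r: "r \<in> U"
    and hyp: "pd k (self_coeff j i) r = pd i (self_coeff j k) r"
  shows "pd k (cross_coeff i j) r + cross_coeff i j r * self_coeff j k r =
    self_coeff i k r * cross_coeff i j r + cross_coeff i k r * cross_coeff k j r"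
proof -
  have c: "pd i (\<lambda>r. pd k (\<phi> j) r) r = pd k (\<lambda>r. pd i (\<phi> j) r) r"
    by (rule pd_commute[OF open_U smooth r])
  have "sin (\<phi> k r - \<phi> j r - (\<phi> i r - \<phi> j r)) \<noteq> 0"
    using sin_nonzero[OF r, of k i] ne by simp
  from trig_compatibility[OF sin_nonzero[OF r ne(1)] sin_nonzero[OF r ne(2)] this
      hyp[unfolded pd_self_coeff[OF not_sym[OF ne(1)] r] pd_self_coeff[OF not_sym[OF ne(2)] r] c]]
  show ?thesis
    unfolding pd_cross_coeff[OF ne(1) r] by (simp add: self_coeff_def cross_coeff_def)
qed

text \<open>The unknowns are \<open>\<mu>\<^sub>i\<close> (as \<open>Inl i\<close>), \<open>g\<close> (as \<open>Inr True\<close>) and \<open>h\<close> (as \<open>Inr False\<close>).\<close>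

definition dirs :: "'n + bool \<Rightarrow> 'n set" where
  "dirs \<alpha> = (case \<alpha> of Inl i \<Rightarrow> - {i} | Inr _ \<Rightarrow> UNIV)"

definition coeff :: "'n + bool \<Rightarrow> 'n \<Rightarrow> 'n + bool \<Rightarrow> real^'n \<Rightarrow> real" where
  "coeff \<alpha> j \<beta> = (case \<alpha> of
      Inl i \<Rightarrow> if \<beta> = Inl i then self_coeff i j else if \<beta> = Inl j then cross_coeff i j else (\<lambda>_. 0)
    | Inr c \<Rightarrow> if \<beta> = Inl j then (\<lambda>r. if c then cos (\<phi> j r) else sin (\<phi> j r)) else (\<lambda>_. 0))"

lemma smooth_coeff: "smooth_on U (coeff \<alpha> j \<beta>)"
proof (cases \<alpha>)
  case (Inl i)
  then show ?thesis by (simp add: coeff_def smooth_self_coeff smooth_cross_coeff smooth_on_const)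
next
  case (Inr c)
  then show ?thesis
    by (cases c) (simp_all add: coeff_def smooth_on_const smooth_on_sin smooth_on_cos open_U smooth)
qed

lemma sum_coeff_Inl:
  assumes "i \<noteq> j"
  shows "(\<Sum>\<beta>\<in>UNIV. coeff (Inl i) j \<beta> r * x \<beta>) = self_coeff i j r * x (Inl i) + cross_coeff i j r * x (Inl j)"
proof -
  have "(\<Sum>\<beta>\<in>UNIV. coeff (Inl i) j \<beta> r * x \<beta>) = (\<Sum>\<beta>\<in>UNIV.
      (if \<beta> = Inl i then self_coeff i j r * x \<beta> else 0) + (if \<beta> = Inl j then cross_coeff i j r * x \<beta> else 0))"
    using assms by (intro sum.cong) (auto simp: coeff_def)
  then show ?thesis by (simp add: sum.distrib)
qed

lemma sum_coeff_Inr: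
  "(\<Sum>\<beta>\<in>UNIV. coeff (Inr c) j \<beta> r * x \<beta>) = (if c then cos (\<phi> j r) else sin (\<phi> j r)) * x (Inl j)"
proof -
  have "(\<Sum>\<beta>\<in>UNIV. coeff (Inr c) j \<beta> r * x \<beta>) = (\<Sum>\<beta>\<in>UNIV.
      (if \<beta> = Inl j then (if c then cos (\<phi> j r) else sin (\<phi> j r)) * x \<beta> else 0))"
    by (intro sum.cong) (auto simp: coeff_def)
  then show ?thesis by simp
qed

lemma pd_cos_sin:
  assumes "r \<in> U"
  shows "pd k (\<lambda>r. cos (\<phi> j r)) r = pd k (\<phi> j) r * - sin (\<phi> j r)"
    and "pd k (\<lambda>r. sin (\<phi> j r)) r = pd k (\<phi> j) r * cos (\<phi> j r)"
  using assms by (intro pd_chain differentiable DERIV_cos DERIV_sin; simp)+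

text \<open>Closedness of the two flux forms, read off at the coefficient of
  \<open>\<mu>\<^sub>j\<close>. It holds by the addition theorems, applied to
  \<open>\<phi> k\<close> as the sum of \<open>\<phi> j\<close> and the phase difference.\<close>

lemma flux_compatible:
  assumes ne: "j \<noteq> k" and r: "r \<in> U"
  shows "pd k (\<lambda>r. cos (\<phi> j r)) r + cos (\<phi> j r) * self_coeff j k r = cos (\<phi> k r) * cross_coeff k j r"
    and "pd k (\<lambda>r. sin (\<phi> j r)) r + sin (\<phi> j r) * self_coeff j k r = sin (\<phi> k r) * cross_coeff k j r"
proof -
  let ?s = "sin (\<phi> k r - \<phi> j r)"
  have s: "?s \<noteq> 0" using sin_nonzero[OF r not_sym[OF ne]] .
  have c: "cos (\<phi> k r) = cos (\<phi> j r) * cos (\<phi> k r - \<phi> j r) - sin (\<phi> j r) * ?s"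
    using cos_add[of "\<phi> j r" "\<phi> k r - \<phi> j r"] by simp
  show "pd k (\<lambda>r. cos (\<phi> j r)) r + cos (\<phi> j r) * self_coeff j k r = cos (\<phi> k r) * cross_coeff k j r"
    unfolding c using s by (simp add: pd_cos_sin[OF r] self_coeff_def cross_coeff_def cot_def field_simps)
  have c: "sin (\<phi> k r) = sin (\<phi> j r) * cos (\<phi> k r - \<phi> j r) + cos (\<phi> j r) * ?s"
    using sin_add[of "\<phi> j r" "\<phi> k r - \<phi> j r"] by simp
  show "pd k (\<lambda>r. sin (\<phi> j r)) r + sin (\<phi> j r) * self_coeff j k r = sin (\<phi> k r) * cross_coeff k j r"
    unfolding c using s by (simp add: pd_cos_sin[OF r] self_coeff_def cross_coeff_def cot_def field_simps)
qed

text \<open>Compares the coefficients of each unknown. For a row entry \<open>Inl i\<close>, the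
  unknown \<open>Inl i\<close> needs the condition itself, and the unknowns \<open>Inl j\<close> and
  \<open>Inl k\<close> need \<open>cross_compatible\<close> with the two directions in both roles.
  For a flux, \<open>flux_compatible\<close> serves both relevant unknowns.\<close>

lemma coeff_compatible:
  assumes cond: "\<And>i j k r. i \<noteq> j \<Longrightarrow> k \<noteq> j \<Longrightarrow> r \<in> U \<Longrightarrow> pd k (self_coeff j i) r = pd i (self_coeff j k) r"
    and j: "j \<in> dirs \<alpha>" and k: "k \<in> dirs \<alpha>" and jk: "j \<noteq> k" and r: "r \<in> U"
  shows "pd k (coeff \<alpha> j \<gamma>) r + (\<Sum>\<beta>\<in>UNIV. coeff \<alpha> j \<beta> r * coeff \<beta> k \<gamma> r) =
    pd j (coeff \<alpha> k \<gamma>) r + (\<Sum>\<beta>\<in>UNIV. coeff \<alpha> k \<beta> r * coeff \<beta> j \<gamma> r)"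
proof (cases \<alpha>)
  case (Inl i)
  then have ne: "i \<noteq> j" "i \<noteq> k" using j k by (auto simp: dirs_def)
  have sym: "pd k (self_coeff i j) r = pd j (self_coeff i k) r"
    using cond[of j i k r] ne r by auto
  have cj: "pd k (cross_coeff i j) r + cross_coeff i j r * self_coeff j k r =
      self_coeff i k r * cross_coeff i j r + cross_coeff i k r * cross_coeff k j r"
    using ne jk r by (intro cross_compatible cond) auto
  have ck: "pd j (cross_coeff i k) r + cross_coeff i k r * self_coeff k j r =
      self_coeff i j r * cross_coeff i k r + cross_coeff i j r * cross_coeff j k r"
    using ne jk r by (intro cross_compatible cond) auto
  consider "\<gamma> = Inl i" | "\<gamma> = Inl j" | "\<gamma> = Inl k" | "\<gamma> \<noteq> Inl i" "\<gamma> \<noteq> Inl j" "\<gamma> \<noteq> Inl k" by blast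
  then show ?thesis
    unfolding Inl sum_coeff_Inl[OF ne(1)] sum_coeff_Inl[OF ne(2)]
    by cases (use ne jk sym cj ck in \<open>simp_all add: coeff_def pd_const\<close>)
next
  case (Inr c)
  show ?thesis
    unfolding Inr sum_coeff_Inr
    using jk flux_compatible[OF jk r] flux_compatible[OF not_sym[OF jk] r]
    by (cases c; cases "\<gamma> = Inl j"; cases "\<gamma> = Inl k") (simp_all add: coeff_def pd_const)
qed

section \<open>From solutions to conservation laws and back\<close>

lemma matrix_diag_mat_mult_vec: "(C ** diag_mat d) *v v = (\<chi> a. \<Sum>l\<in>UNIV. C $ a $ l * d l * v $ l)"
  by (simp add: matrix_vector_mult_def matrix_matrix_mult_def diag_mat_def vec_eq_iff
      if_distrib[of "\<lambda>x. _ * x"] cong: if_cong)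

lemma has_derivative_flux:
  assumes f: "\<And>a. smooth_on V (f a)" and r: "r \<in> V"
    and pd: "\<And>a l. pd l (f a) r = d l * C $ a $ l"
  shows "((\<lambda>r. \<chi> a. f a r) has_derivative (\<lambda>v. (C ** diag_mat d) *v v)) (at r)"
proof -
  have "(f a has_derivative (\<lambda>v. ((C ** diag_mat d) *v v) $ a)) (at r)" for a
  proof (rule has_derivative_eq_rhs[OF smooth_on_has_derivative[OF f r]], rule ext)
    fix v
    have "frechet_derivative (f a) (at r) v = (\<Sum>l\<in>UNIV. v $ l *\<^sub>R pd l (f a) r)"
      by (rule linear_axis_expansion[OF has_derivative_linear[OF smooth_on_has_derivative[OF f r]]])
    then show "frechet_derivative (f a) (at r) v = ((C ** diag_mat d) *v v) $ a"
      by (simp add: matrix_diag_mat_mult_vec pd mult_ac)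
  qed
  then show ?thesis
    by (subst has_derivative_componentwise_within) (auto simp: Basis_vec_def inner_axis)
qed

text \<open>Solving once for each unit vector as initial value of \<open>\<mu>\<close> yields rows
  that form the identity matrix at \<open>p\<close>. By continuity of the determinant they stay
  independent nearby.\<close>

lemma conservation_form_if_commute:
  assumes cond: "\<And>i j k r. i \<noteq> j \<Longrightarrow> k \<noteq> j \<Longrightarrow> r \<in> U \<Longrightarrow> pd k (self_coeff j i) r = pd i (self_coeff j k) r"
  shows "locally_conservation_form U (\<lambda>r. diag_mat (\<lambda>i. cos (\<phi> i r))) (\<lambda>r. diag_mat (\<lambda>i. sin (\<phi> i r)))"
  unfolding locally_conservation_form_def
proof
  fix p assume p: "p \<in> U"
  \<comment> \<open>Only \<open>\<beta> = Inl k\<close> misses the direction \<open>k\<close>, and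
    the equation for the derivative of \<open>\<alpha>\<close> along \<open>j\<close> involves no
    row entry besides \<open>j\<close> and that of \<open>\<alpha>\<close> itself, both different
    from \<open>k\<close>.\<close>
  have closed: "coeff \<alpha> j \<beta> r = 0"
    if "j \<in> dirs \<alpha>" "k \<in> dirs \<alpha>" "j \<noteq> k" "k \<notin> dirs \<beta>" "r \<in> U" for \<alpha> j k \<beta> r
    using that by (auto simp: dirs_def coeff_def split: sum.splits)
  have compatible: "pd k (coeff \<alpha> j \<gamma>) r + (\<Sum>\<beta>\<in>UNIV. coeff \<alpha> j \<beta> r * coeff \<beta> k \<gamma> r) =
      pd j (coeff \<alpha> k \<gamma>) r + (\<Sum>\<beta>\<in>UNIV. coeff \<alpha> k \<beta> r * coeff \<beta> j \<gamma> r)"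
    if "j \<in> dirs \<alpha>" "k \<in> dirs \<alpha>" "j \<noteq> k" "r \<in> U" for \<alpha> j k \<gamma> r
    by (rule coeff_compatible[OF _ that]) (rule cond)
  have "\<exists>\<delta>>0. ball p \<delta> \<subseteq> U \<and> (\<forall>c. \<exists>u. \<forall>\<alpha>. smooth_on (ball p \<delta>) (u \<alpha>) \<and> u \<alpha> p = c \<alpha> \<and>
      (\<forall>j\<in>dirs \<alpha>. \<forall>r\<in>ball p \<delta>. pd j (u \<alpha>) r = (\<Sum>\<beta>\<in>UNIV. coeff \<alpha> j \<beta> r * u \<beta> r)))"
    by (rule Darboux_linear_system[where D = dirs, OF open_U p smooth_coeff])
      ((rule closed; assumption), (rule compatible; assumption))
  then obtain \<delta> where \<delta>: "\<delta> > 0" "ball p \<delta> \<subseteq> U"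
    and ex: "\<forall>c. \<exists>u. \<forall>\<alpha>. smooth_on (ball p \<delta>) (u \<alpha>) \<and> u \<alpha> p = c \<alpha> \<and>
      (\<forall>j\<in>dirs \<alpha>. \<forall>r\<in>ball p \<delta>. pd j (u \<alpha>) r = (\<Sum>\<beta>\<in>UNIV. coeff \<alpha> j \<beta> r * u \<beta> r))"
    by blast
  have "\<exists>u. \<forall>a \<alpha>. smooth_on (ball p \<delta>) (u a \<alpha>) \<and> u a \<alpha> p = (if \<alpha> = Inl a then 1 else 0) \<and>
      (\<forall>j\<in>dirs \<alpha>. \<forall>r\<in>ball p \<delta>. pd j (u a \<alpha>) r = (\<Sum>\<beta>\<in>UNIV. coeff \<alpha> j \<beta> r * u a \<beta> r))"
    by (rule choice, rule allI, rule ex[rule_format])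
  then obtain u where u: "\<And>a \<alpha>. smooth_on (ball p \<delta>) (u a \<alpha>)"
    and up: "\<And>a \<alpha>. u a \<alpha> p = (if \<alpha> = Inl a then 1 else 0)"
    and pd_u: "\<And>a \<alpha> j r. j \<in> dirs \<alpha> \<Longrightarrow> r \<in> ball p \<delta> \<Longrightarrow> pd j (u a \<alpha>) r = (\<Sum>\<beta>\<in>UNIV. coeff \<alpha> j \<beta> r * u a \<beta> r)"
    by blast
  define C where "C r = (\<chi> a i. u a (Inl i) r)" for r
  define V where "V = {r \<in> ball p \<delta>. det (C r) \<noteq> 0}"
  have "continuous_on (ball p \<delta>) (\<lambda>r. det (C r))"
    unfolding det_def C_def by (auto intro!: continuous_intros smooth_on_continuous_on[OF u])
  then have "open (ball p \<delta> \<inter> (\<lambda>r. det (C r)) -` (- {0}))"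
    by (rule continuous_open_preimage) auto
  moreover have "V = ball p \<delta> \<inter> (\<lambda>r. det (C r)) -` (- {0})" by (auto simp: V_def)
  ultimately have V: "open V" "V \<subseteq> ball p \<delta>" by auto
  have uV: "smooth_on V (u a \<alpha>)" for a \<alpha> using smooth_on_subset[OF u V(2)] .
  have "C p = mat 1" by (auto simp: C_def up mat_def vec_eq_iff)
  then have "p \<in> V" using \<delta>(1) by (simp add: V_def)
  moreover have "conservation_form_on V (\<lambda>r. diag_mat (\<lambda>i. cos (\<phi> i r))) (\<lambda>r. diag_mat (\<lambda>i. sin (\<phi> i r)))"
    unfolding conservation_form_on_def
  proof (intro exI conjI ballI)
    show "smooth_on V (\<lambda>r. \<chi> a. u a (Inr True) r)" "smooth_on V (\<lambda>r. \<chi> a. u a (Inr False) r)" "smooth_on V C"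
      unfolding C_def[abs_def] by (intro smooth_on_vec V uV)+
    fix r assume r: "r \<in> V"
    then have rb: "r \<in> ball p \<delta>" using V by blast
    show "invertible (C r)" using r by (simp add: V_def invertible_det_nz)
    have "pd l (u a (Inr c)) r = (if c then cos (\<phi> l r) else sin (\<phi> l r)) * C r $ a $ l" for a l c
      using pd_u[of l "Inr c" r a] rb by (simp add: sum_coeff_Inr C_def dirs_def)
    then show "((\<lambda>r. \<chi> a. u a (Inr True) r) has_derivative (\<lambda>v. (C r ** diag_mat (\<lambda>i. cos (\<phi> i r))) *v v)) (at r)"
      "((\<lambda>r. \<chi> a. u a (Inr False) r) has_derivative (\<lambda>v. (C r ** diag_mat (\<lambda>i. sin (\<phi> i r))) *v v)) (at r)"
      by (intro has_derivative_flux[OF uV r]; simp)+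
  qed
  ultimately show "\<exists>V. open V \<and> p \<in> V \<and> V \<subseteq> U \<and>
      conservation_form_on V (\<lambda>r. diag_mat (\<lambda>i. cos (\<phi> i r))) (\<lambda>r. diag_mat (\<lambda>i. sin (\<phi> i r)))"
    using V \<delta> by blast
qed

text \<open>
  Commuting the second derivatives of \<open>\<mu>\<^sub>i\<close> gives a linear relation between \<open>\<mu>\<^sub>i\<close>, \<open>\<mu>\<^sub>j\<close> and \<open>\<mu>\<^sub>k\<close> that
  all rows of \<open>C\<close> satisfy. As \<open>C\<close> is invertible, the coefficient of \<open>\<mu>\<^sub>i\<close> vanishes.
\<close>

lemma commute_if_conservation_form:
  assumes cons: "locally_conservation_form U (\<lambda>r. diag_mat (\<lambda>i. cos (\<phi> i r))) (\<lambda>r. diag_mat (\<lambda>i. sin (\<phi> i r)))"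
    and ne: "j \<noteq> i" "k \<noteq> i" "j \<noteq> k" and p: "p \<in> U"
  shows "pd k (self_coeff i j) p = pd j (self_coeff i k) p"
proof -
  obtain V g h C where V: "open V" "p \<in> V" "V \<subseteq> U"
    and smooth': "smooth_on V g" "smooth_on V h" "smooth_on V (C :: real^'n \<Rightarrow> real^'n^'n)"
    and inv: "\<And>r. r \<in> V \<Longrightarrow> invertible (C r)"
    and g: "\<And>r. r \<in> V \<Longrightarrow> (g has_derivative (\<lambda>v. (C r ** diag_mat (\<lambda>i. cos (\<phi> i r))) *v v)) (at r)"
    and h: "\<And>r. r \<in> V \<Longrightarrow> (h has_derivative (\<lambda>v. (C r ** diag_mat (\<lambda>i. sin (\<phi> i r))) *v v)) (at r)"
    using cons p unfolding locally_conservation_form_def conservation_form_on_def by metis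
  have V_U: "r \<in> U" if "r \<in> V" for r using V that by blast
  define \<mu> where "\<mu> a i r = C r $ a $ i" for a i r
  have \<mu>: "smooth_on V (\<mu> a i)" for a i
    unfolding \<mu>_def[abs_def]
    by (intro smooth_on_bounded_linear[OF V(1) bounded_linear_vec_nth] smooth_on_bounded_linear[OF V(1) bounded_linear_vec_nth smooth'(3)])
  have \<mu>_diff: "\<mu> a i differentiable (at r)" if "r \<in> V" for a i r
    using smooth_on_differentiable[OF \<mu> that] .
  have cs_diff: "(\<lambda>r. cos (\<phi> i r)) differentiable (at r)" "(\<lambda>r. sin (\<phi> i r)) differentiable (at r)"
    if "r \<in> V" for i r
    using V_U[OF that] by (auto intro!: smooth_on_differentiable[of U] smooth_on_cos smooth_on_sin open_U smooth)
  \<comment> \<open>Symmetry of the second derivatives of a flux component; \<open>d\<close> stands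
    for the cosines or the sines, so that one argument covers \<open>g\<close> and
    \<open>h\<close>.\<close>
  have flux: "pd l (\<mu> a i) r * d i r + \<mu> a i r * pd l (d i) r = pd i (\<mu> a l) r * d l r + \<mu> a l r * pd i (d l) r"
    if f: "smooth_on V f" "\<And>r. r \<in> V \<Longrightarrow> (f has_derivative (\<lambda>v. (C r ** diag_mat (\<lambda>i. d i r)) *v v)) (at r)"
      and d: "\<And>i r. r \<in> V \<Longrightarrow> d i differentiable (at r)" and r: "r \<in> V"
    for f :: "real^'n \<Rightarrow> real^'n" and d l a i r
  proof -
    have pd_f: "pd l (\<lambda>r. f r $ a) r = \<mu> a l r * d l r" if "r \<in> V" for l r
    proof -
      have "pd l (\<lambda>r. f r $ a) r = ((C r ** diag_mat (\<lambda>i. d i r)) *v axis l 1) $ a"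
        by (rule pd_eqI[OF bounded_linear.has_derivative[OF bounded_linear_vec_nth f(2)[OF that]]])
      then show ?thesis
        by (simp add: matrix_diag_mat_mult_vec \<mu>_def axis_def if_distrib[of "\<lambda>x. _ * x"] cong: if_cong)
    qed
    have pd2: "pd m (\<lambda>r. pd l (\<lambda>r. f r $ a) r) r = \<mu> a l r * pd m (d l) r + pd m (\<mu> a l) r * d l r" for l m
      using pd_cong[OF V(1) r pd_f[of _ l], where k = m] \<mu>_diff[OF r] d[OF r] by (simp add: pd_mult)
    have "pd l (\<lambda>r. pd i (\<lambda>r. f r $ a) r) r = pd i (\<lambda>r. pd l (\<lambda>r. f r $ a) r) r"
      by (rule pd_commute[OF V(1) smooth_on_component[OF V(1) f(1)] r])
    then show ?thesis unfolding pd2 by (simp add: mult_ac)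
  qed
  have pd_\<mu>: "pd l (\<mu> a i) r = self_coeff i l r * \<mu> a i r + cross_coeff i l r * \<mu> a l r"
    if il: "i \<noteq> l" and r: "r \<in> V" for a i l r
  proof -
    let ?s = "sin (\<phi> i r - \<phi> l r)"
    have s: "?s \<noteq> 0" using sin_nonzero[OF V_U[OF r] il] .
    let ?x = "pd l (\<mu> a i) r" and ?y = "pd i (\<mu> a l) r"
    have 1: "?x * cos (\<phi> i r) + \<mu> a i r * (pd l (\<phi> i) r * - sin (\<phi> i r)) =
        ?y * cos (\<phi> l r) + \<mu> a l r * (pd i (\<phi> l) r * - sin (\<phi> l r))"
      using flux[OF smooth'(1) g cs_diff(1) r, where l = l and a = a and i = i] by (simp add: pd_cos_sin[OF V_U[OF r]])
    have 2: "?x * sin (\<phi> i r) + \<mu> a i r * (pd l (\<phi> i) r * cos (\<phi> i r)) =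
        ?y * sin (\<phi> l r) + \<mu> a l r * (pd i (\<phi> l) r * cos (\<phi> l r))"
      using flux[OF smooth'(2) h cs_diff(2) r, where l = l and a = a and i = i] by (simp add: pd_cos_sin[OF V_U[OF r]])
    \<comment> \<open>This combination of the two equations eliminates \<open>?y\<close> and leaves
      \<open>?x\<close> with the factor \<open>?s\<close>.\<close>
    have "(?x * sin (\<phi> i r) + \<mu> a i r * (pd l (\<phi> i) r * cos (\<phi> i r))) * cos (\<phi> l r)
        - (?x * cos (\<phi> i r) + \<mu> a i r * (pd l (\<phi> i) r * - sin (\<phi> i r))) * sin (\<phi> l r) =
        \<mu> a l r * pd i (\<phi> l) r"
      unfolding 1 2 using sin_cos_squared_add2[of "\<phi> l r"] by algebra
    then have "?x * ?s + \<mu> a i r * pd l (\<phi> i) r * cos (\<phi> i r - \<phi> l r) = \<mu> a l r * pd i (\<phi> l) r"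
      by (simp add: sin_diff cos_diff algebra_simps)
    moreover have cot: "cot (\<phi> l r - \<phi> i r) = - (cos (\<phi> i r - \<phi> l r) / ?s)"
      using sin_minus[of "\<phi> i r - \<phi> l r"] cos_minus[of "\<phi> i r - \<phi> l r"] by (simp add: cot_def)
    ultimately show ?thesis
      using s unfolding self_coeff_def cross_coeff_def cot by (simp add: field_simps)
  qed
  have diff: "self_coeff i l differentiable (at p)" "cross_coeff i l differentiable (at p)" for i l
    using differentiable p by auto
  \<comment> \<open>\<open>j\<close> and \<open>k\<close> are fresh here, because the formula is
    also needed with both exchanged.\<close>
  have pd2: "pd k (\<lambda>r. pd j (\<mu> a i) r) p =
      (pd k (self_coeff i j) p + self_coeff i j p * self_coeff i k p) * \<mu> a i p
      + (pd k (cross_coeff i j) p + cross_coeff i j p * self_coeff j k p) * \<mu> a j p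
      + (self_coeff i j p * cross_coeff i k p + cross_coeff i j p * cross_coeff j k p) * \<mu> a k p"
    if "i \<noteq> j" "i \<noteq> k" "j \<noteq> k" for a j k
  proof -
    have "pd k (\<lambda>r. pd j (\<mu> a i) r) p = pd k (\<lambda>r. self_coeff i j r * \<mu> a i r + cross_coeff i j r * \<mu> a j r) p"
      using that V diff \<mu>_diff by (intro pd_cong[OF V(1,2)] pd_\<mu>) auto
    also have "\<dots> = self_coeff i j p * pd k (\<mu> a i) p + pd k (self_coeff i j) p * \<mu> a i p
        + (cross_coeff i j p * pd k (\<mu> a j) p + pd k (cross_coeff i j) p * \<mu> a j p)"
      using V diff \<mu>_diff by (simp add: pd_add pd_mult)
    finally show ?thesis using that V by (simp add: pd_\<mu> algebra_simps)
  qed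
  define x where "x = pd k (self_coeff i j) p - pd j (self_coeff i k) p"
  have "\<exists>y z. \<forall>a. x * \<mu> a i p + y * \<mu> a j p + z * \<mu> a k p = 0"
  proof (intro exI allI)
    fix a
    have "pd k (\<lambda>r. pd j (\<mu> a i) r) p = pd j (\<lambda>r. pd k (\<mu> a i) r) p"
      by (rule pd_commute[OF V(1) \<mu> V(2)])
    then show "x * \<mu> a i p
      + ((pd k (cross_coeff i j) p + cross_coeff i j p * self_coeff j k p) - (self_coeff i k p * cross_coeff i j p + cross_coeff i k p * cross_coeff k j p)) * \<mu> a j p
      + ((self_coeff i j p * cross_coeff i k p + cross_coeff i j p * cross_coeff j k p) - (pd j (cross_coeff i k) p + cross_coeff i k p * self_coeff k j p)) * \<mu> a k p = 0"
      using pd2[of j k a] pd2[of k j a] ne by (simp add: x_def algebra_simps)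
  qed
  then obtain y z where yz: "\<And>a. x * \<mu> a i p + y * \<mu> a j p + z * \<mu> a k p = 0" by blast
  \<comment> \<open>The relation for all rows says that \<open>C p\<close> annihilates this vector.
    As \<open>i\<close>, \<open>j\<close>, \<open>k\<close> are distinct, its entry at
    \<open>i\<close> is \<open>x\<close>.\<close>
  let ?v = "x *\<^sub>R axis i 1 + y *\<^sub>R axis j 1 + z *\<^sub>R axis k 1 :: real^'n"
  have "C p *v ?v = 0"
    using yz by (simp add: vec_eq_iff matrix_vector_right_distrib matrix_vector_mult_scaleR
        matrix_vector_mult_basis column_def \<mu>_def)
  then have "?v = 0"
    using inv[OF V(2)] by (metis invertible_def matrix_left_invertible_ker)
  then have "?v $ i = 0" by simp
  then show ?thesis using ne by (simp add: x_def axis_def)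
qed

end

theorem theorem1p3:
  fixes \<phi> :: "'n::finite \<Rightarrow> real^'n \<Rightarrow> real"
    and U :: "(real^'n) set"
  assumes "open U"
    and smooth: "\<And>i. smooth_on U (\<phi> i)"
    and strictly_hyperbolic:
      "\<And>i j r. r \<in> U \<Longrightarrow> i \<noteq> j \<Longrightarrow> \<not> [\<phi> i r = \<phi> j r] (rmod pi)"
  shows "(\<forall>i j k. i \<noteq> j \<longrightarrow> k \<noteq> j \<longrightarrow> (\<forall>r\<in>U.
            partial_deriv k (\<lambda>s. partial_deriv i (\<phi> j) s * cot (\<phi> i s - \<phi> j s)) r =
            partial_deriv i (\<lambda>s. partial_deriv k (\<phi> j) s * cot (\<phi> k s - \<phi> j s)) r))
     \<longleftrightarrow> locally_conservation_form U
            (\<lambda>r. diag_mat (\<lambda>i. cos (\<phi> i r))) (\<lambda>r. diag_mat (\<lambda>i. sin (\<phi> i r)))"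
proof -
  have "sin (\<phi> i r - \<phi> j r) \<noteq> 0" if r: "r \<in> U" and ij: "i \<noteq> j" for i j r
  proof
    assume "sin (\<phi> i r - \<phi> j r) = 0"
    then obtain m :: int where "\<phi> i r - \<phi> j r = of_int m * pi"
      using sin_zero_iff_int2 by blast
    \<comment> \<open>The congruence expresses the second angle as the first plus a multiple of
      \<open>pi\<close>, hence the sign of the witness.\<close>
    then have "[\<phi> i r = \<phi> j r] (rmod pi)"
      unfolding rcong_altdef by (intro exI[of _ "- m"]) (simp add: algebra_simps)
    then show False using strictly_hyperbolic[OF r ij] by simp
  qed
  then interpret diagonal_system \<phi> U
    using assms by unfold_locales auto
  \<comment> \<open>The outer derivative sees a whole neighbourhood, so the inner
    \<open>partial_deriv\<close> is replaced on all of the open set \<open>U\<close> before the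
    outer one is converted.\<close>
  have pd_eq: "partial_deriv k (\<lambda>s. partial_deriv i (\<phi> j) s * cot (\<phi> i s - \<phi> j s)) r = pd k (self_coeff j i) r"
    if "r \<in> U" for i j k r
  proof -
    have d: "self_coeff j i differentiable (at r)" by (rule differentiable(2)[OF that])
    have eq: "partial_deriv i (\<phi> j) s * cot (\<phi> i s - \<phi> j s) = self_coeff j i s" if "s \<in> U" for s
      using that by (simp add: self_coeff_def partial_deriv_eq_pd differentiable)
    have "((\<lambda>s. partial_deriv i (\<phi> j) s * cot (\<phi> i s - \<phi> j s)) has_derivative frechet_derivative (self_coeff j i) (at r)) (at r)"
      by (rule has_derivative_transform_within_open[OF frechet_derivative_works[THEN iffD1, OF d] open_U that])
        (simp add: eq)
    then show ?thesis by (subst partial_deriv_eq_pd[OF differentiableI]) (assumption, rule pd_eqI)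
  qed
  show ?thesis
  proof
    assume "\<forall>i j k. i \<noteq> j \<longrightarrow> k \<noteq> j \<longrightarrow> (\<forall>r\<in>U.
            partial_deriv k (\<lambda>s. partial_deriv i (\<phi> j) s * cot (\<phi> i s - \<phi> j s)) r =
            partial_deriv i (\<lambda>s. partial_deriv k (\<phi> j) s * cot (\<phi> k s - \<phi> j s)) r)"
    then show "locally_conservation_form U (\<lambda>r. diag_mat (\<lambda>i. cos (\<phi> i r))) (\<lambda>r. diag_mat (\<lambda>i. sin (\<phi> i r)))"
      by (intro conservation_form_if_commute) (simp add: pd_eq)
  next
    assume cons: "locally_conservation_form U (\<lambda>r. diag_mat (\<lambda>i. cos (\<phi> i r))) (\<lambda>r. diag_mat (\<lambda>i. sin (\<phi> i r)))"
    have "pd k (self_coeff j i) r = pd i (self_coeff j k) r" if "i \<noteq> j" "k \<noteq> j" "r \<in> U" for i j k r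
      \<comment> \<open>The case \<open>i = k\<close>, excluded in that lemma, is trivial because
        both sides coincide.\<close>
      using commute_if_conservation_form[OF cons that(1,2) _ that(3)] by (cases "i = k") auto
    then show "\<forall>i j k. i \<noteq> j \<longrightarrow> k \<noteq> j \<longrightarrow> (\<forall>r\<in>U.
            partial_deriv k (\<lambda>s. partial_deriv i (\<phi> j) s * cot (\<phi> i s - \<phi> j s)) r =
            partial_deriv i (\<lambda>s. partial_deriv k (\<phi> j) s * cot (\<phi> k s - \<phi> j s)) r)"
      by (simp add: pd_eq)
  qed
qed

end
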